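(* Assume the balanced setting: $G$ is balanced, all weights $a_{N,n}$ are radial, and all polynomials belong to $H(a_{N,n})_0(G)$ for all $N,n$. (1) If $AH(G)=\mathcal{V}H(G)$ holds algebraically and topologically, then $\mathcal{A}$ satisfies the conditions $(\mathrm{B})^{\sim}$ and $(\mathrm{wQ})^{\sim}_{\mathrm{in}}$. (2) Assume that all the spaces $(\mathcal{A}_N)_0H(G)$, $N\in\mathbb{N}$, are complete. If $(AH)_0(G)=\mathcal{V}_0H(G)$ holds algebraically and topologically, then $\mathcal{A}$ satisfies the conditions $(\mathrm{B})^{\sim}$ and $(\mathrm{wQ})^{\sim}_{\mathrm{in}}$.
   Context: $\mathbb{N}=\{1,2,\dots\}$. $G$ is a non-empty open subset of $\mathbb{C}^d$, $d\geq 1$; $H(G)$ is the space of holomorphic functions on $G$, and co denotes the topology of uniform convergence on compact subsets of $G$. A weight on $G$ is a strictly positive continuous function on $G$. For a weight $a$: $Ha(G)=\{f\in H(G): \|f\|_a:=\sup_{z\in G}a(z)|f(z)|<\infty\}$, a Banach space with norm $\|\cdot\|_a$, and $Ha_0(G)=\{f\in H(G): a|f| \text{ vanishes at } \infty\text{ on } G\}$, a closed subspace. ($g\colon G\to\mathbb{R}$ vanishes at $\infty$ on $G$ if for each $\varepsilon>0$ there is a compact $K\subseteq G$ with $|g(z)|<\varepsilon$ for $z\in G\setminus K$.) $\mathcal{A}=((a_{N,n})_{n\in\mathbb{N}})_{N\in\mathbb{N}}$ is a double sequence of weights on $G$ with $a_{N,n+1}\leq a_{N,n}\leq a_{N+1,n}$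 for all $N,n$. With locally convex inductive and projective limits and inclusions as linking maps, put $\mathcal{A}_NH(G):=\operatorname{ind}_nHa_{N,n}(G)$, $(\mathcal{A}_N)_0H(G):=\operatorname{ind}_nH(a_{N,n})_0(G)$, $AH(G):=\operatorname{proj}_N\mathcal{A}_NH(G)$, $(AH)_0(G):=\operatorname{proj}_N(\mathcal{A}_N)_0H(G)$, $\mathcal{V}H(G):=\operatorname{ind}_n\operatorname{proj}_NHa_{N,n}(G)$ and $\mathcal{V}_0H(G):=\operatorname{ind}_n\operatorname{proj}_NH(a_{N,n})_0(G)$. One always has continuous inclusions $\mathcal{V}H(G)\subseteq AH(G)$ and $\mathcal{V}_0H(G)\subseteq(AH)_0(G)$. Balanced setting: $G$ is balanced ($\lambda z\in G$ for $z\in G$, $|\lambda|\leq 1$), each weight $a$ in $\mathcal{A}$ is radial ($a(\lambda z)=a(z)$ for $|\lambda|=1$), the Banach space topologies of the spaces $Ha_{N,n}(G)$ are stronger than co, and the polynomials are contained in all the spaces $H(a_{N,n})_0(G)$. For a strictly positive continuous function $w$ on $G$, $(w)^{\sim}(z):=\sup\{|g(z)|:g\in H(G),\ |g|\leq w\text{ on }G\}$. For a weight $a$, the associated weight is $\tilde a:=1/(1/a)^{\sim}$. Condition $(\mathrm{B})^{\sim}$: for every sequence $(n(N))_{N\in\mathbb{N}}\subseteq\mathbb{N}$ there exists $m$ such that for every $M$ there exist $L$ and $c>0$ with $\tilde a_{M,m}\leq c\,\tilde b$ on $G$, where $\tilde b$ is the weight associated with the weight $b=\max_{N=1,\dots,L}a_{N,n(N)}$.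 Condition $(\mathrm{wQ})^{\sim}_{\mathrm{in}}$: for every $N$ there exist $M\geq N$ and $n$ such that for all $K\geq M$ and $m$ there exist $k$ and $S>0$ with $$\Big(\frac{1}{a_{M,m}}\Big)^{\sim}\leq S\max\Big(\Big(\frac{1}{a_{N,n}}\Big)^{\sim},\Big(\frac{1}{a_{K,k}}\Big)^{\sim}\Big)\quad\text{on } G.$$ *)

theory Defs
  imports "HOL-Analysis.Analysis"
begin

(* Index convention: the positive integers 1, 2, ... that index the double sequence of
   weights and its subsequences are represented by type nat through N |-> N - 1, so that
   max over N = 1..L becomes a maximum over {..L}.

   A space of functions on G is a set of functions on the whole type that vanish outside G;
   in this way equality, inclusion and the vector space operations of such functions are
   those of the functions on G.  A topological vector space of functions is given by its
   topology, its underlying set being the topspace. *)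

section \<open>Locally convex topologies on spaces of complex functions\<close>

definition fun_subspace :: "('x \<Rightarrow> complex) set \<Rightarrow> bool" where
  "fun_subspace E \<longleftrightarrow> (\<lambda>x. 0) \<in> E \<and>
     (\<forall>f\<in>E. \<forall>g\<in>E. (\<lambda>x. f x + g x) \<in> E) \<and> (\<forall>c. \<forall>f\<in>E. (\<lambda>x. c * f x) \<in> E)"

definition fun_convex :: "('x \<Rightarrow> complex) set \<Rightarrow> bool" where
  "fun_convex V \<longleftrightarrow>
     (\<forall>f\<in>V. \<forall>g\<in>V. \<forall>t\<in>{0..1::real}. (\<lambda>x. of_real (1 - t) * f x + of_real t * g x) \<in> V)"

definition lc_topology :: "('x \<Rightarrow> complex) topology \<Rightarrow> bool" where
  "lc_topology T \<longleftrightarrow> fun_subspace (topspace T) \<and>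
     continuous_map (prod_topology T T) T (\<lambda>(f, g). \<lambda>x. f x + g x) \<and>
     continuous_map (prod_topology euclidean T) T (\<lambda>(c, f). \<lambda>x. c * f x) \<and>
     (\<forall>U. openin T U \<and> (\<lambda>x. 0) \<in> U \<longrightarrow>
        (\<exists>V W. fun_convex V \<and> openin T W \<and> (\<lambda>x. 0) \<in> W \<and> W \<subseteq> V \<and> V \<subseteq> U))"

(* The inductive limit of an increasing sequence of spaces, the linking maps being inclusions:
   the finest locally convex topology on the union that makes all inclusions continuous, that
   is, the supremum of all such topologies (see lc_ind_lc_topology, continuous_map_lc_ind
   and lc_ind_finest below). *)
definition lc_ind :: "(nat \<Rightarrow> ('x \<Rightarrow> complex) topology) \<Rightarrow> ('x \<Rightarrow> complex) topology" where
  "lc_ind E = topology_generated_by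
     {U. \<exists>T. lc_topology T \<and> topspace T = (\<Union>n. topspace (E n)) \<and>
             (\<forall>n. continuous_map (E n) T (\<lambda>f. f)) \<and> openin T U}"

(* The projective limit of a decreasing sequence of spaces, the linking maps being inclusions:
   the intersection with the initial topology. *)
definition lc_proj :: "(nat \<Rightarrow> ('x \<Rightarrow> complex) topology) \<Rightarrow> ('x \<Rightarrow> complex) topology" where
  "lc_proj E = topology_generated_by
     {U \<inter> (\<Inter>N. topspace (E N)) |U N. openin (E N) U}"

(* Every Cauchy filter (equivalently, every Cauchy net) converges. *)
definition lc_complete :: "('x \<Rightarrow> complex) topology \<Rightarrow> bool" where
  "lc_complete T \<longleftrightarrow>
     (\<forall>F. F \<noteq> bot \<and> (\<forall>\<^sub>F f in F. f \<in> topspace T) \<and>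
          (\<forall>U. openin T U \<and> (\<lambda>x. 0) \<in> U \<longrightarrow>
             (\<forall>\<^sub>F (f, g) in F \<times>\<^sub>F F. (\<lambda>x. f x - g x) \<in> U)) \<longrightarrow>
          (\<exists>l. limitin T (\<lambda>f. f) l F))"

lemma topspace_lc_proj: "topspace (lc_proj E) = (\<Inter>N. topspace (E N))"
proof -
  have "topspace (E 0) \<inter> (\<Inter>N. topspace (E N)) = (\<Inter>N. topspace (E N))" by auto
  then have "(\<Inter>N. topspace (E N)) \<in> {U \<inter> (\<Inter>N. topspace (E N)) |U N. openin (E N) U}"
    using openin_topspace[of "E 0"] by (metis (mono_tags, lifting) mem_Collect_eq)
  then show ?thesis
    unfolding lc_proj_def topology_generated_by_topspace by auto
qed

lemma lc_topology_indiscrete: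
  assumes "fun_subspace S"
  shows "lc_topology (topology_generated_by {S})" and "topspace (topology_generated_by {S}) = S"
proof -
  let ?T = "topology_generated_by {S}"
  show ts: "topspace ?T = S" by simp
  have op: "openin ?T S" using openin_topspace[of ?T] by simp
  have gen: "U = {} \<or> U = S" if "openin ?T U" for U
  proof -
    have "generate_topology_on {S} U" using that openin_topology_generated_by_iff by blast
    then show ?thesis by induction auto
  qed
  have cont: "continuous_map X ?T h" if "\<And>x. x \<in> topspace X \<Longrightarrow> h x \<in> S"
    for X :: "'b topology" and h
  proof (rule continuous_on_generated_topo)
    show "openin X (h -` U \<inter> topspace X)" if "U \<in> {S}" for U
    proof -
      have "h -` U \<inter> topspace X = topspace X"
        using that \<open>\<And>x. x \<in> topspace X \<Longrightarrow> h x \<in> S\<close> by auto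
      then show ?thesis by simp
    qed
    show "h ` topspace X \<subseteq> \<Union> {S}"
      using \<open>\<And>x. x \<in> topspace X \<Longrightarrow> h x \<in> S\<close> by auto
  qed
  have conv: "fun_convex S"
    using assms unfolding fun_subspace_def fun_convex_def by simp
  show "lc_topology ?T"
    unfolding lc_topology_def ts
  proof (intro conjI allI impI)
    show "fun_subspace S" by fact
    show "continuous_map (prod_topology ?T ?T) ?T (\<lambda>(f, g). \<lambda>x. f x + g x)"
      using assms unfolding fun_subspace_def by (intro cont) auto
    show "continuous_map (prod_topology euclidean ?T) ?T (\<lambda>(c, f). \<lambda>x. c * f x)"
      using assms unfolding fun_subspace_def by (intro cont) auto
    show "\<exists>V W. fun_convex V \<and> openin ?T W \<and> (\<lambda>x. 0) \<in> W \<and> W \<subseteq> V \<and> V \<subseteq> U"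
      if "openin ?T U \<and> (\<lambda>x. 0) \<in> U" for U
      using gen[of U] that conv op by blast
  qed
qed

lemma fun_subspace_INT:
  assumes "\<And>N. fun_subspace (S N)"
  shows "fun_subspace (\<Inter>N. S N)"
  using assms unfolding fun_subspace_def by auto

lemma fun_subspace_UN_incseq:
  assumes "\<And>n. fun_subspace (S n)" and "incseq S"
  shows "fun_subspace (\<Union>n. S n)"
  unfolding fun_subspace_def
proof (intro conjI ballI allI)
  fix f g assume "f \<in> (\<Union>n. S n)" "g \<in> (\<Union>n. S n)"
  then obtain i j where "f \<in> S i" "g \<in> S j" by blast
  then have "f \<in> S (max i j)" "g \<in> S (max i j)"
    using assms(2) by (meson incseqD max.cobounded1 max.cobounded2 subsetD)+
  then have "(\<lambda>x. f x + g x) \<in> S (max i j)"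
    using assms(1)[of "max i j"] unfolding fun_subspace_def by blast
  then show "(\<lambda>x. f x + g x) \<in> (\<Union>n. S n)" by (rule UN_I[OF UNIV_I])
next
  fix c f assume "f \<in> (\<Union>n. S n)"
  then obtain i where "f \<in> S i" by blast
  then have "(\<lambda>x. c * f x) \<in> S i" using assms(1)[of i] unfolding fun_subspace_def by blast
  then show "(\<lambda>x. c * f x) \<in> (\<Union>n. S n)" by (rule UN_I[OF UNIV_I])
next
  have "(\<lambda>x. 0) \<in> S 0" using assms(1)[of 0] unfolding fun_subspace_def by blast
  then show "(\<lambda>x. 0) \<in> (\<Union>n. S n)" by (rule UN_I[OF UNIV_I])
qed

lemma topspace_lc_ind:
  assumes "fun_subspace (\<Union>n. topspace (E n))"
  shows "topspace (lc_ind E) = (\<Union>n. topspace (E n))"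
proof
  let ?S = "\<Union>n. topspace (E n)"
  show "topspace (lc_ind E) \<subseteq> ?S"
    unfolding lc_ind_def topology_generated_by_topspace using openin_subset by blast
  let ?T = "topology_generated_by {?S}"
  have 1: "lc_topology ?T" "topspace ?T = ?S" using lc_topology_indiscrete[OF assms] by auto
  have 2: "continuous_map (E n) ?T (\<lambda>f. f)" for n
  proof (rule continuous_on_generated_topo)
    show "openin (E n) ((\<lambda>f. f) -` U \<inter> topspace (E n))" if "U \<in> {?S}" for U
    proof -
      have "(\<lambda>f. f) -` U \<inter> topspace (E n) = topspace (E n)" using that by auto
      then show ?thesis by simp
    qed
  qed auto
  have "openin ?T ?S" using 1(2) openin_topspace[of ?T] by metis
  then have "?S \<in> {U. \<exists>T. lc_topology T \<and> topspace T = ?S \<and>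
             (\<forall>n. continuous_map (E n) T (\<lambda>f. f)) \<and> openin T U}"
    using 1 2 by blast
  then show "?S \<subseteq> topspace (lc_ind E)"
    unfolding lc_ind_def topology_generated_by_topspace by blast
qed

lemma lc_ind_finest:
  assumes "lc_topology T" and "topspace T = (\<Union>n. topspace (E n))"
    and "\<And>n. continuous_map (E n) T (\<lambda>f. f)"
  shows "continuous_map (lc_ind E) T (\<lambda>f. f)"
proof -
  have sub: "fun_subspace (\<Union>n. topspace (E n))"
    using assms(1,2) unfolding lc_topology_def by simp
  have "openin (lc_ind E) U" if "openin T U" for U
    unfolding lc_ind_def using that assms by (intro topology_generated_by_Basis) blast
  moreover have "{f \<in> topspace (lc_ind E). f \<in> U} = U" if "openin T U" for U
    using openin_subset[OF that] topspace_lc_ind[OF sub] assms(2) by auto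
  ultimately show ?thesis
    using topspace_lc_ind[OF sub] assms(2) by (auto simp: continuous_map_def)
qed

lemma continuous_map_into_lc_ind:
  assumes sub: "fun_subspace (\<Union>n. topspace (E n))"
    and "h ` topspace X \<subseteq> (\<Union>n. topspace (E n))"
    and "\<And>T. lc_topology T \<Longrightarrow> topspace T = (\<Union>n. topspace (E n)) \<Longrightarrow>
           (\<And>n. continuous_map (E n) T (\<lambda>f. f)) \<Longrightarrow> continuous_map X T h"
  shows "continuous_map X (lc_ind E) h"
  unfolding lc_ind_def
proof (rule continuous_on_generated_topo)
  let ?B = "{U. \<exists>T. lc_topology T \<and> topspace T = (\<Union>n. topspace (E n)) \<and>
             (\<forall>n. continuous_map (E n) T (\<lambda>f. f)) \<and> openin T U}"
  show "openin X (h -` U \<inter> topspace X)" if U: "U \<in> ?B" for U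
  proof -
    obtain T where T: "lc_topology T" "topspace T = (\<Union>n. topspace (E n))"
      "\<And>n. continuous_map (E n) T (\<lambda>f. f)" "openin T U" using U by blast
    have "h -` U \<inter> topspace X = {x \<in> topspace X. h x \<in> U}" by auto
    then show ?thesis using assms(3)[OF T(1-3)] T(4) openin_continuous_map_preimage by metis
  qed
  show "h ` topspace X \<subseteq> \<Union> ?B"
    using assms(2) topspace_lc_ind[OF sub]
    unfolding lc_ind_def topology_generated_by_topspace by simp
qed

lemma continuous_map_lc_ind:
  assumes "fun_subspace (\<Union>n. topspace (E n))"
  shows "continuous_map (E n) (lc_ind E) (\<lambda>f. f)"
  by (rule continuous_map_into_lc_ind[OF assms]) auto

lemma lc_ind_lc_topology:
  assumes sub: "fun_subspace (\<Union>n. topspace (E n))"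
  shows "lc_topology (lc_ind E)"
proof -
  let ?S = "\<Union>n. topspace (E n)"
  let ?I = "lc_ind E"
  have ts: "topspace ?I = ?S" by (rule topspace_lc_ind[OF sub])
  have sub': "fun_subspace (topspace ?I)" using sub ts by simp
  have fin: "continuous_map ?I T (\<lambda>f. f)"
    if "lc_topology T" "topspace T = ?S" "\<And>n. continuous_map (E n) T (\<lambda>f. f)" for T
    using lc_ind_finest[OF that] .
  have add: "continuous_map (prod_topology ?I ?I) ?I (\<lambda>(f, g). \<lambda>x. f x + g x)"
  proof (rule continuous_map_into_lc_ind[OF sub])
    show "(\<lambda>(f, g). \<lambda>x. f x + g x) ` topspace (prod_topology ?I ?I) \<subseteq> ?S"
      using sub' unfolding ts[symmetric] fun_subspace_def by auto
    fix T assume T: "lc_topology T" "topspace T = ?S" "\<And>n. continuous_map (E n) T (\<lambda>f. f)"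
    have "continuous_map (prod_topology ?I ?I) (prod_topology T T) (\<lambda>(f, g). (f, g))"
      using continuous_map_prod_top[of ?I ?I T T "\<lambda>f. f" "\<lambda>f. f"] fin[OF T] by simp
    then have "continuous_map (prod_topology ?I ?I) T
        ((\<lambda>(f, g). \<lambda>x. f x + g x) \<circ> (\<lambda>(f, g). (f, g)))"
      using T(1) unfolding lc_topology_def by (blast intro: continuous_map_compose)
    then show "continuous_map (prod_topology ?I ?I) T (\<lambda>(f, g). \<lambda>x. f x + g x)"
      by (simp add: comp_def case_prod_unfold)
  qed
  have scale: "continuous_map (prod_topology euclidean ?I) ?I (\<lambda>(c, f). \<lambda>x. c * f x)"
  proof (rule continuous_map_into_lc_ind[OF sub])
    show "(\<lambda>(c, f). \<lambda>x. c * f x) ` topspace (prod_topology euclidean ?I) \<subseteq> ?S"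
      using sub' unfolding ts[symmetric] fun_subspace_def by auto
    fix T assume T: "lc_topology T" "topspace T = ?S" "\<And>n. continuous_map (E n) T (\<lambda>f. f)"
    have "continuous_map (prod_topology euclidean ?I) (prod_topology euclidean T)
        (\<lambda>(c::complex, f). (c, f))"
      using continuous_map_prod_top[of "euclidean :: complex topology" ?I euclidean T
          "\<lambda>c. c" "\<lambda>f. f"] fin[OF T] by simp
    then have "continuous_map (prod_topology euclidean ?I) T
        ((\<lambda>(c, f). \<lambda>x. c * f x) \<circ> (\<lambda>(c, f). (c, f)))"
      using T(1) unfolding lc_topology_def by (blast intro: continuous_map_compose)
    then show "continuous_map (prod_topology euclidean ?I) T (\<lambda>(c, f). \<lambda>x. c * f x)"
      by (simp add: comp_def case_prod_unfold)
  qed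
  have conv: "\<exists>V W. fun_convex V \<and> openin ?I W \<and> (\<lambda>x. 0) \<in> W \<and> W \<subseteq> V \<and> V \<subseteq> U"
    if "openin ?I U" and zU: "(\<lambda>x. 0) \<in> U" for U
  proof -
    let ?B = "{U. \<exists>T. lc_topology T \<and> topspace T = ?S \<and>
             (\<forall>n. continuous_map (E n) T (\<lambda>f. f)) \<and> openin T U}"
    have "generate_topology_on ?B U"
      using that(1) unfolding lc_ind_def openin_topology_generated_by_iff .
    then show ?thesis using zU
    proof induction
      case Empty then show ?case by simp
    next
      case (Int a b)
      from Int.IH(1) Int.prems obtain V W where
        1: "fun_convex V" "openin ?I W" "(\<lambda>x. 0) \<in> W" "W \<subseteq> V" "V \<subseteq> a" by auto
      from Int.IH(2) Int.prems obtain V' W' where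
        2: "fun_convex V'" "openin ?I W'" "(\<lambda>x. 0) \<in> W'" "W' \<subseteq> V'" "V' \<subseteq> b" by auto
      have "fun_convex (V \<inter> V')" using 1(1) 2(1) unfolding fun_convex_def by simp
      moreover have "openin ?I (W \<inter> W')" using 1(2) 2(2) by (rule openin_Int)
      moreover have "(\<lambda>x. 0) \<in> W \<inter> W'" using 1(3) 2(3) by simp
      moreover have "W \<inter> W' \<subseteq> V \<inter> V'" using 1(4) 2(4) by (rule Int_mono)
      moreover have "V \<inter> V' \<subseteq> a \<inter> b" using 1(5) 2(5) by (rule Int_mono)
      ultimately show ?case by blast
    next
      case (UN K)
      then obtain k where k: "k \<in> K" "(\<lambda>x. 0) \<in> k" by blast
      from UN.IH[OF k] k(1) show ?case by (meson Union_upper order_trans)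
    next
      case (Basis U)
      then obtain T where T: "lc_topology T" "topspace T = ?S"
        "\<And>n. continuous_map (E n) T (\<lambda>f. f)" "openin T U" by blast
      then obtain V W where VW: "fun_convex V" "openin T W" "(\<lambda>x. 0) \<in> W" "W \<subseteq> V" "V \<subseteq> U"
        using Basis.prems unfolding lc_topology_def by meson
      have "openin ?I W"
        unfolding lc_ind_def using T VW(2) by (intro topology_generated_by_Basis) blast
      then show ?case using VW by blast
    qed
  qed
  show ?thesis
    unfolding lc_topology_def
  proof (intro conjI allI impI)
    show "\<exists>V W. fun_convex V \<and> openin ?I W \<and> (\<lambda>x. 0) \<in> W \<and> W \<subseteq> V \<and> V \<subseteq> U"
      if "openin ?I U \<and> (\<lambda>x. 0) \<in> U" for U
      using that conv[of U] by (elim conjE)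
  qed (fact sub' add scale)+
qed


section \<open>Weighted spaces of holomorphic functions\<close>

definition holo :: "(complex^'d) set \<Rightarrow> (complex^'d \<Rightarrow> complex) set" where
  "holo G = {f. (\<forall>z\<in>G. \<exists>D. (f has_derivative D) (at z) \<and> (\<forall>c v. D (c *s v) = c * D v)) \<and>
                (\<forall>z. z \<notin> G \<longrightarrow> f z = 0)}"

definition co_topology :: "(complex^'d) set \<Rightarrow> (complex^'d \<Rightarrow> complex) topology" where
  "co_topology G = topology_generated_by
     {{g \<in> holo G. \<forall>z\<in>K. norm (g z - f z) < e} |f K e.
        f \<in> holo G \<and> compact K \<and> K \<subseteq> G \<and> e > 0}"

definition weight :: "(complex^'d) set \<Rightarrow> (complex^'d \<Rightarrow> real) \<Rightarrow> bool" where
  "weight G a \<longleftrightarrow> continuous_on G a \<and> (\<forall>z\<in>G. a z > 0)"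

definition wnorm :: "(complex^'d) set \<Rightarrow> (complex^'d \<Rightarrow> real) \<Rightarrow> (complex^'d \<Rightarrow> complex) \<Rightarrow> real" where
  "wnorm G a f = (SUP z\<in>G. a z * norm (f z))"

definition Ha_set :: "(complex^'d) set \<Rightarrow> (complex^'d \<Rightarrow> real) \<Rightarrow> (complex^'d \<Rightarrow> complex) set" where
  "Ha_set G a = {f \<in> holo G. bdd_above ((\<lambda>z. a z * norm (f z)) ` G)}"

definition Ha :: "(complex^'d) set \<Rightarrow> (complex^'d \<Rightarrow> real) \<Rightarrow> (complex^'d \<Rightarrow> complex) topology" where
  "Ha G a = topology_generated_by
     {{g \<in> Ha_set G a. wnorm G a (\<lambda>z. g z - f z) < r} |f r. f \<in> Ha_set G a}"

definition vanishes_at_inf_on :: "(complex^'d) set \<Rightarrow> (complex^'d \<Rightarrow> real) \<Rightarrow> bool" where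
  "vanishes_at_inf_on G g \<longleftrightarrow>
     (\<forall>e>0. \<exists>K. compact K \<and> K \<subseteq> G \<and> (\<forall>z\<in>G - K. \<bar>g z\<bar> < e))"

definition Ha0_set :: "(complex^'d) set \<Rightarrow> (complex^'d \<Rightarrow> real) \<Rightarrow> (complex^'d \<Rightarrow> complex) set" where
  "Ha0_set G a = {f \<in> holo G. vanishes_at_inf_on G (\<lambda>z. a z * norm (f z))}"

definition Ha0 :: "(complex^'d) set \<Rightarrow> (complex^'d \<Rightarrow> real) \<Rightarrow> (complex^'d \<Rightarrow> complex) topology" where
  "Ha0 G a = subtopology (Ha G a) (Ha0_set G a)"

definition weight_system :: "(complex^'d) set \<Rightarrow> (nat \<Rightarrow> nat \<Rightarrow> complex^'d \<Rightarrow> real) \<Rightarrow> bool" where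
  "weight_system G A \<longleftrightarrow>
     (\<forall>N n. weight G (A N n)) \<and>
     (\<forall>N n. \<forall>z\<in>G. A N (Suc n) z \<le> A N n z \<and> A N n z \<le> A (Suc N) n z)"

definition ANH :: "(complex^'d) set \<Rightarrow> (nat \<Rightarrow> nat \<Rightarrow> complex^'d \<Rightarrow> real) \<Rightarrow> nat \<Rightarrow>
    (complex^'d \<Rightarrow> complex) topology" where
  "ANH G A N = lc_ind (\<lambda>n. Ha G (A N n))"

definition AN0H :: "(complex^'d) set \<Rightarrow> (nat \<Rightarrow> nat \<Rightarrow> complex^'d \<Rightarrow> real) \<Rightarrow> nat \<Rightarrow>
    (complex^'d \<Rightarrow> complex) topology" where
  "AN0H G A N = lc_ind (\<lambda>n. Ha0 G (A N n))"

definition AH :: "(complex^'d) set \<Rightarrow> (nat \<Rightarrow> nat \<Rightarrow> complex^'d \<Rightarrow> real) \<Rightarrow>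
    (complex^'d \<Rightarrow> complex) topology" where
  "AH G A = lc_proj (\<lambda>N. ANH G A N)"

definition AH0 :: "(complex^'d) set \<Rightarrow> (nat \<Rightarrow> nat \<Rightarrow> complex^'d \<Rightarrow> real) \<Rightarrow>
    (complex^'d \<Rightarrow> complex) topology" where
  "AH0 G A = lc_proj (\<lambda>N. AN0H G A N)"

definition VH :: "(complex^'d) set \<Rightarrow> (nat \<Rightarrow> nat \<Rightarrow> complex^'d \<Rightarrow> real) \<Rightarrow>
    (complex^'d \<Rightarrow> complex) topology" where
  "VH G A = lc_ind (\<lambda>n. lc_proj (\<lambda>N. Ha G (A N n)))"

definition V0H :: "(complex^'d) set \<Rightarrow> (nat \<Rightarrow> nat \<Rightarrow> complex^'d \<Rightarrow> real) \<Rightarrow>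
    (complex^'d \<Rightarrow> complex) topology" where
  "V0H G A = lc_ind (\<lambda>n. lc_proj (\<lambda>N. Ha0 G (A N n)))"


section \<open>The balanced setting and the conditions on the weights\<close>

definition balanced :: "(complex^'d) set \<Rightarrow> bool" where
  "balanced G \<longleftrightarrow> (\<forall>z\<in>G. \<forall>c. norm c \<le> 1 \<longrightarrow> c *s z \<in> G)"

definition radial :: "(complex^'d) set \<Rightarrow> (complex^'d \<Rightarrow> real) \<Rightarrow> bool" where
  "radial G a \<longleftrightarrow> (\<forall>z\<in>G. \<forall>c. norm c = 1 \<longrightarrow> a (c *s z) = a z)"

(* The library's polynomial_function is real polynomiality, which also admits conjugates. *)
definition complex_polynomial :: "(complex^'d \<Rightarrow> complex) \<Rightarrow> bool" where
  "complex_polynomial p \<longleftrightarrow>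
     (\<exists>(I :: ('d \<Rightarrow> nat) set) c. finite I \<and>
        p = (\<lambda>z. \<Sum>\<alpha>\<in>I. c \<alpha> * (\<Prod>i\<in>UNIV. (z $ i) ^ \<alpha> i)))"

definition balanced_setting :: "(complex^'d) set \<Rightarrow> (nat \<Rightarrow> nat \<Rightarrow> complex^'d \<Rightarrow> real) \<Rightarrow> bool" where
  "balanced_setting G A \<longleftrightarrow>
     balanced G \<and>
     (\<forall>N n. radial G (A N n)) \<and>
     (\<forall>N n. continuous_map (Ha G (A N n)) (co_topology G) (\<lambda>f. f)) \<and>
     (\<forall>N n p. complex_polynomial p \<longrightarrow> (\<lambda>z. if z \<in> G then p z else 0) \<in> Ha0_set G (A N n))"

definition assoc_growth :: "(complex^'d) set \<Rightarrow> (complex^'d \<Rightarrow> real) \<Rightarrow> complex^'d \<Rightarrow> real" where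
  "assoc_growth G w z = Sup {norm (g z) |g. g \<in> holo G \<and> (\<forall>x\<in>G. norm (g x) \<le> w x)}"

(* In the balanced setting the constants belong to all the weighted spaces, so the growth
   function inverted here is strictly positive on G. *)
definition assoc_weight :: "(complex^'d) set \<Rightarrow> (complex^'d \<Rightarrow> real) \<Rightarrow> complex^'d \<Rightarrow> real" where
  "assoc_weight G a z = 1 / assoc_growth G (\<lambda>x. 1 / a x) z"

definition cond_B :: "(complex^'d) set \<Rightarrow> (nat \<Rightarrow> nat \<Rightarrow> complex^'d \<Rightarrow> real) \<Rightarrow> bool" where
  "cond_B G A \<longleftrightarrow>
     (\<forall>n :: nat \<Rightarrow> nat. \<exists>m. \<forall>M. \<exists>L. \<exists>c>0. \<forall>z\<in>G.
        assoc_weight G (A M m) z \<le>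
          c * assoc_weight G (\<lambda>x. Max ((\<lambda>N. A N (n N) x) ` {..L})) z)"

definition cond_wQ_in :: "(complex^'d) set \<Rightarrow> (nat \<Rightarrow> nat \<Rightarrow> complex^'d \<Rightarrow> real) \<Rightarrow> bool" where
  "cond_wQ_in G A \<longleftrightarrow>
     (\<forall>N. \<exists>M\<ge>N. \<exists>n. \<forall>K\<ge>M. \<forall>m. \<exists>k. \<exists>S>0. \<forall>z\<in>G.
        assoc_growth G (\<lambda>x. 1 / A M m x) z \<le>
          S * max (assoc_growth G (\<lambda>x. 1 / A N n x) z) (assoc_growth G (\<lambda>x. 1 / A K k x) z))"

end

(* Evaluations at points are functionals whose dual norm in the step A N n is the growth function
   (1/A N n)~ at the point.  If (wQ)in fails, suitable multiples of evaluations are uniformly bounded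
   on a neighbourhood of zero of every step of VH, hence on a neighbourhood of zero of VH = AH, that
   is, of some step of AH; this contradicts the choice of the multiples.  If (B) fails, a gliding
   hump of polynomials converges in every projective step to an element of AH outside VH.  Both
   arguments need functions of the unit balls to be replaced by polynomials: dilations f(r z) and
   their Taylor sections stay within twice the bound that f satisfies on circles, so radial weights
   are respected. *)
theory Submission
  imports Defs "HOL-Complex_Analysis.Conformal_Mappings" "HOL-Computational_Algebra.Polynomial"
begin

section \<open>Complex polynomials in several variables\<close>

text \<open>The equality of the two limits says something only about functions that lie in them, and
  a function in the unit ball of a single step \<open>Ha G (A M m)\<close> need not do so.
  Polynomials lie in every step, also with vanishing at infinity; hence they are the test functions.
  The price is a factor 2, harmless because both conditions leave a constant free. In (wQ) the
  multiples are reciprocals of the maxima on the right-hand side of the violated inequality. The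
  step M that carries the neighbourhood of zero is known only after the family of evaluations is
  fixed. The family is therefore doubly indexed: row j refutes the choice M = n = N + j, the
  constant grows along the row, and row j = M yields the contradiction. In (B) a single function
  must leave the step of every m, so the hump returns to each m infinitely often. Taylor expansion
  in several variables is reduced to complex lines: homogeneous components are Taylor coefficients
  of slices, and their polynomial dependence on the point comes from Liouville's theorem and
  interpolation.\<close>

lemma complex_polynomial_const: "complex_polynomial (\<lambda>z. a)"
  unfolding complex_polynomial_def
  by (intro exI[of _ "{\<lambda>_. 0}"] exI[of _ "\<lambda>_. a"]) simp

lemma complex_polynomial_add:
  assumes "complex_polynomial p" "complex_polynomial q"
  shows "complex_polynomial (\<lambda>z. p z + q z)"
proof -
  obtain I c where I: "finite I" "p = (\<lambda>z. \<Sum>\<alpha>\<in>I. c \<alpha> * (\<Prod>i\<in>UNIV. (z $ i) ^ \<alpha> i))"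
    using assms(1) unfolding complex_polynomial_def by blast
  obtain J d where J: "finite J" "q = (\<lambda>z. \<Sum>\<alpha>\<in>J. d \<alpha> * (\<Prod>i\<in>UNIV. (z $ i) ^ \<alpha> i))"
    using assms(2) unfolding complex_polynomial_def by blast
  let ?c = "\<lambda>\<alpha>. if \<alpha> \<in> I then c \<alpha> else 0" and ?d = "\<lambda>\<alpha>. if \<alpha> \<in> J then d \<alpha> else 0"
  have "p z = (\<Sum>\<alpha>\<in>I \<union> J. ?c \<alpha> * (\<Prod>i\<in>UNIV. (z $ i) ^ \<alpha> i))" for z
    unfolding I(2) using I(1) J(1) by (intro sum.mono_neutral_cong_left) auto
  moreover have "q z = (\<Sum>\<alpha>\<in>I \<union> J. ?d \<alpha> * (\<Prod>i\<in>UNIV. (z $ i) ^ \<alpha> i))" for z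
    unfolding J(2) using I(1) J(1) by (intro sum.mono_neutral_cong_left) auto
  ultimately have "(\<lambda>z. p z + q z) =
      (\<lambda>z. \<Sum>\<alpha>\<in>I \<union> J. (?c \<alpha> + ?d \<alpha>) * (\<Prod>i\<in>UNIV. (z $ i) ^ \<alpha> i))"
    by (simp add: sum.distrib distrib_right)
  then show ?thesis
    unfolding complex_polynomial_def using I(1) J(1)
    by (intro exI[of _ "I \<union> J"] exI[of _ "\<lambda>\<alpha>. ?c \<alpha> + ?d \<alpha>"] conjI finite_UnI) auto
qed

lemma complex_polynomial_cmult:
  assumes "complex_polynomial p"
  shows "complex_polynomial (\<lambda>z. a * p z)"
proof -
  obtain I c where I: "finite I" "p = (\<lambda>z. \<Sum>\<alpha>\<in>I. c \<alpha> * (\<Prod>i\<in>UNIV. (z $ i) ^ \<alpha> i))"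
    using assms unfolding complex_polynomial_def by blast
  then show ?thesis
    unfolding complex_polynomial_def
    by (intro exI[of _ I] exI[of _ "\<lambda>\<alpha>. a * c \<alpha>"]) (simp add: sum_distrib_left mult.assoc)
qed

lemma complex_polynomial_coord_mult:
  fixes p :: "complex^'d \<Rightarrow> complex"
  assumes "complex_polynomial p"
  shows "complex_polynomial (\<lambda>z. z $ j * p z)"
proof -
  obtain I c where I: "finite I" "p = (\<lambda>z. \<Sum>\<alpha>\<in>I. c \<alpha> * (\<Prod>i\<in>UNIV. (z $ i) ^ \<alpha> i))"
    using assms unfolding complex_polynomial_def by blast
  define s :: "('d \<Rightarrow> nat) \<Rightarrow> ('d \<Rightarrow> nat)" where "s \<alpha> = \<alpha>(j := Suc (\<alpha> j))" for \<alpha>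
  define r :: "('d \<Rightarrow> nat) \<Rightarrow> ('d \<Rightarrow> nat)" where "r \<alpha> = \<alpha>(j := \<alpha> j - 1)" for \<alpha>
  have rs: "r (s \<alpha>) = \<alpha>" for \<alpha> by (auto simp: r_def s_def fun_eq_iff)
  then have inj: "inj_on s I" by (metis inj_onI)
  have mono: "(\<Prod>i\<in>UNIV. (z $ i) ^ s \<alpha> i) = z $ j * (\<Prod>i\<in>UNIV. (z $ i) ^ \<alpha> i)"
    for z :: "complex^'d" and \<alpha>
  proof -
    have "(\<Prod>i\<in>UNIV. (z $ i) ^ s \<alpha> i) = (z $ j) ^ s \<alpha> j * (\<Prod>i\<in>UNIV - {j}. (z $ i) ^ s \<alpha> i)"
      by (rule prod.remove) auto
    also have "(\<Prod>i\<in>UNIV - {j}. (z $ i) ^ s \<alpha> i) = (\<Prod>i\<in>UNIV - {j}. (z $ i) ^ \<alpha> i)"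
      by (intro prod.cong) (auto simp: s_def)
    also have "(z $ j) ^ s \<alpha> j * \<dots> = z $ j * ((z $ j) ^ \<alpha> j * \<dots>)" by (simp add: s_def)
    also have "(z $ j) ^ \<alpha> j * (\<Prod>i\<in>UNIV - {j}. (z $ i) ^ \<alpha> i) = (\<Prod>i\<in>UNIV. (z $ i) ^ \<alpha> i)"
      by (rule prod.remove[symmetric]) auto
    finally show ?thesis .
  qed
  have "(\<lambda>z. z $ j * p z) = (\<lambda>z. \<Sum>\<alpha>\<in>s ` I. c (r \<alpha>) * (\<Prod>i\<in>UNIV. (z $ i) ^ \<alpha> i))"
    by (simp add: I(2) sum.reindex[OF inj] rs mono sum_distrib_left mult.left_commute)
  then show ?thesis
    unfolding complex_polynomial_def using I(1)
    by (intro exI[of _ "s ` I"] exI[of _ "\<lambda>\<alpha>. c (r \<alpha>)"]) auto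
qed

lemma complex_polynomial_sum:
  assumes "\<And>k. k \<in> K \<Longrightarrow> complex_polynomial (p k)"
  shows "complex_polynomial (\<lambda>z. \<Sum>k\<in>K. p k z)"
  using assms
  by (induction K rule: infinite_finite_induct)
     (auto simp: complex_polynomial_const intro!: complex_polynomial_add)

lemma complex_polynomial_poly_mult:
  assumes "complex_polynomial p"
  shows "complex_polynomial (\<lambda>z. poly q (z $ j) * p z)"
proof (induction q)
  case 0 then show ?case by (simp add: complex_polynomial_const)
next
  case (pCons a q)
  have "complex_polynomial (\<lambda>z. a * p z + z $ j * (poly q (z $ j) * p z))"
    by (intro complex_polynomial_add complex_polynomial_cmult complex_polynomial_coord_mult
        assms pCons.IH)
  then show ?case by (simp add: algebra_simps)
qed

text \<open>The order of quantifiers is the point: the cardinal functions \<open>l\<close> serve all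
  \<open>p\<close> at once. When \<open>p\<close> depends on further variables, only the values
  \<open>poly p a\<close> carry that dependence.\<close>

lemma lagrange_interpolation:
  fixes A :: "'a::field set"
  assumes "finite A"
  shows "\<exists>l. \<forall>p. degree p < card A \<longrightarrow> (\<forall>x. poly p x = (\<Sum>a\<in>A. poly p a * poly (l a) x))"
proof -
  define g where "g a = (\<Prod>b\<in>A - {a}. [:- b, 1:])" for a :: 'a
  define l where "l a = smult (1 / poly (g a) a) (g a)" for a
  have g0: "poly (g a) b = 0 \<longleftrightarrow> b \<in> A - {a}" for a b
    using assms by (auto simp: g_def poly_prod)
  have dg: "degree (g a) = card (A - {a})" for a
    unfolding g_def using assms by (subst degree_prod_eq_sum_degree) auto
  have dl: "degree (l a) \<le> card A - 1" if "a \<in> A" for a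
    using that dg[of a] card_Diff_singleton[OF that] degree_smult_le[of "1 / poly (g a) a" "g a"]
    by (simp add: l_def)
  have lv: "poly (l a) b = (if b = a then 1 else 0)" if "a \<in> A" "b \<in> A" for a b
    using that g0[of a b] g0[of a a] by (auto simp: l_def)
  have "p = (\<Sum>a\<in>A. smult (poly p a) (l a))" if p: "degree p < card A" for p
  proof (rule poly_eqI_degree)
    show "poly p x = poly (\<Sum>a\<in>A. smult (poly p a) (l a)) x" if "x \<in> A" for x
      using that assms by (simp add: poly_sum lv if_distrib cong: if_cong sum.cong)
    have "degree (\<Sum>a\<in>A. smult (poly p a) (l a)) \<le> card A - 1"
      using dl by (intro degree_sum_le assms order_trans[OF degree_smult_le])
    then show "degree (\<Sum>a\<in>A. smult (poly p a) (l a)) < card A" using p by linarith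
  qed (rule p)
  then have "\<forall>p. degree p < card A \<longrightarrow> (\<forall>x. poly p x = (\<Sum>a\<in>A. poly p a * poly (l a) x))"
    by (metis (no_types, lifting) poly_smult poly_sum sum.cong)
  then show ?thesis by blast
qed

text \<open>Because the degree bound \<open>k\<close> is uniform, the same k + 1 nodes interpolate
  in every coordinate and on every line. Each coordinate that is set free is expanded by Lagrange
  interpolation, which leaves functions with that coordinate frozen at a node.\<close>

lemma complex_polynomial_if_separately:
  fixes F :: "complex^'d \<Rightarrow> complex"
  assumes sep: "\<And>z i. \<exists>p. degree p \<le> k \<and> (\<forall>\<zeta>. F (\<chi> j. if j = i then \<zeta> else z $ j) = poly p \<zeta>)"
  shows "complex_polynomial F"
proof -
  define A where "A = complex_of_nat ` {..k}"
  have A: "finite A" "card A = Suc k"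
    unfolding A_def by (auto simp: card_image inj_on_def)
  obtain l where l: "\<And>p x. degree p \<le> k \<Longrightarrow> poly p x = (\<Sum>a\<in>A. poly p a * poly (l a) x)"
    using lagrange_interpolation[OF A(1)] A(2) by (metis less_Suc_eq_le)
  have "\<forall>y. complex_polynomial (\<lambda>z. F (\<chi> j. if j \<in> S then z $ j else y $ j))" if "finite S" for S
    using that
  proof induction
    case empty then show ?case by (simp add: complex_polynomial_const)
  next
    case (insert i S)
    show ?case
    proof
      fix y :: "complex^'d"
      let ?y = "\<lambda>a. \<chi> j. if j = i then a else y $ j"
      have "F (\<chi> j. if j \<in> insert i S then z $ j else y $ j) =
          (\<Sum>a\<in>A. poly (l a) (z $ i) * F (\<chi> j. if j \<in> S then z $ j else ?y a $ j))" for z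
      proof -
        let ?m = "\<chi> j. if j \<in> S then z $ j else y $ j"
        obtain p where p: "degree p \<le> k" "\<And>\<zeta>. F (\<chi> j. if j = i then \<zeta> else ?m $ j) = poly p \<zeta>"
          using sep by blast
        have "(\<chi> j. if j \<in> insert i S then z $ j else y $ j) = (\<chi> j. if j = i then z $ i else ?m $ j)"
          using insert.hyps by (auto simp: vec_eq_iff)
        moreover have "(\<chi> j. if j \<in> S then z $ j else ?y a $ j) = (\<chi> j. if j = i then a else ?m $ j)"
          for a using insert.hyps by (auto simp: vec_eq_iff)
        ultimately show ?thesis
          using l[OF p(1), of "z $ i"] unfolding p(2)[symmetric] by (simp add: mult.commute)
      qed
      then show "complex_polynomial (\<lambda>z. F (\<chi> j. if j \<in> insert i S then z $ j else y $ j))"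
        using insert.IH by (simp add: complex_polynomial_sum complex_polynomial_poly_mult)
    qed
  qed
  from this[of UNIV] show ?thesis by (simp add: vec_lambda_eta)
qed

section \<open>Homogeneous components of a holomorphic function\<close>

lemma norm_cvec_scale: "norm (c *s z) = norm c * norm z" for z :: "complex^'d"
  unfolding norm_vec_def by (simp add: norm_mult L2_set_right_distrib)

lemma bounded_linear_cvec_scale: "bounded_linear (\<lambda>c. c *s z)" for z :: "complex^'d"
  by (rule bounded_linear_intro[where K = "norm z"])
     (auto simp: vec_eq_iff algebra_simps norm_cvec_scale)

lemmas continuous_on_cvec_scale = bounded_linear.continuous_on[OF bounded_linear_cvec_scale]

text \<open>Complex homogeneity of \<open>D\<close> turns the real derivative along the line into
  multiplication by the number \<open>D v\<close>.\<close>

lemma has_field_derivative_line: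
  fixes f :: "complex^'d \<Rightarrow> complex"
  assumes D: "(f has_derivative D) (at (z + \<zeta> *s v))" "\<And>c v. D (c *s v) = c * D v"
  shows "((\<lambda>\<zeta>. f (z + \<zeta> *s v)) has_field_derivative D v) (at \<zeta>)"
proof -
  have "((\<lambda>\<zeta>. z + \<zeta> *s v) has_derivative (\<lambda>h. h *s v)) (at \<zeta>)"
    by (intro has_derivative_eq_rhs[OF has_derivative_add[OF has_derivative_const
          bounded_linear_imp_has_derivative[OF bounded_linear_cvec_scale]]]) simp
  from diff_chain_at[OF this D(1)]
  have "((\<lambda>\<zeta>. f (z + \<zeta> *s v)) has_derivative (\<lambda>h. D v * h)) (at \<zeta>)"
    by (simp add: comp_def D(2) mult.commute)
  then show ?thesis unfolding has_field_derivative_def .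
qed

lemma holo_line:
  fixes f :: "complex^'d \<Rightarrow> complex"
  assumes "f \<in> holo G"
  shows "(\<lambda>\<zeta>. f (z + \<zeta> *s v)) holomorphic_on {\<zeta>. z + \<zeta> *s v \<in> G}"
proof (rule holomorphic_onI)
  fix \<zeta> assume "\<zeta> \<in> {\<zeta>. z + \<zeta> *s v \<in> G}"
  then obtain D where D: "(f has_derivative D) (at (z + \<zeta> *s v))" "\<And>c v. D (c *s v) = c * D v"
    using assms unfolding holo_def by blast
  show "(\<lambda>\<zeta>. f (z + \<zeta> *s v)) field_differentiable at \<zeta> within {\<zeta>. z + \<zeta> *s v \<in> G}"
    using has_field_derivative_line[OF D] field_differentiable_at_within field_differentiable_def
    by blast
qed

lemma open_cvec_line:
  fixes z v :: "complex^'d"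
  assumes "open G"
  shows "open {\<zeta>. z + \<zeta> *s v \<in> G}"
proof -
  have "continuous_on UNIV (\<lambda>\<zeta>. z + \<zeta> *s v)"
    by (intro continuous_on_add continuous_on_const continuous_on_cvec_scale continuous_on_id)
  from open_vimage[OF assms this] show ?thesis by (simp add: vimage_def)
qed

lemma holo_continuous_on: "f \<in> holo G \<Longrightarrow> continuous_on G f"
  unfolding holo_def
  by (auto intro!: continuous_at_imp_continuous_on dest!: has_derivative_continuous)

text \<open>The j-th Taylor coefficient at 0 of the slice through \<open>z\<close>. It is taken for
  each \<open>z\<close> separately, so one-variable theory suffices, but that it is a polynomial in
  \<open>z\<close> has to be proved.\<close>

definition hom_comp :: "(complex^'d \<Rightarrow> complex) \<Rightarrow> nat \<Rightarrow> complex^'d \<Rightarrow> complex" where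
  "hom_comp f j z = (deriv ^^ j) (\<lambda>\<zeta>. f (\<zeta> *s z)) 0 / fact j"

context
  fixes G :: "(complex^'d) set" and f :: "complex^'d \<Rightarrow> complex"
  assumes G: "open G" "balanced G" and f: "f \<in> holo G"
begin

lemma holo_radial: "(\<lambda>\<zeta>. f (\<zeta> *s z)) holomorphic_on {\<zeta>. \<zeta> *s z \<in> G}"
  using holo_line[OF f, of 0 z] by simp

lemma open_radial: "open {\<zeta>. \<zeta> *s z \<in> G}"
  using open_cvec_line[OF G(1), of 0 z] by simp

lemma radial_disc: "z \<in> G \<Longrightarrow> cball 0 1 \<subseteq> {\<zeta>. \<zeta> *s z \<in> G}"
  using G(2) unfolding balanced_def by auto

text \<open>Cauchy's inequality on the unit circle of the slice. Only the values of \<open>f\<close>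
  on the circle through \<open>z\<close> enter, and there a radial weight is constant.\<close>

lemma norm_hom_comp_le:
  assumes "z \<in> G" and "\<And>c. norm c = 1 \<Longrightarrow> norm (f (c *s z)) \<le> B"
  shows "norm (hom_comp f j z) \<le> B"
proof -
  have h: "(\<lambda>\<zeta>. f (\<zeta> *s z)) holomorphic_on cball 0 1"
    using holo_radial radial_disc[OF assms(1)] by (rule holomorphic_on_subset)
  have "norm ((deriv ^^ j) (\<lambda>\<zeta>. f (\<zeta> *s z)) 0) \<le> fact j * B / 1 ^ j"
    using h assms(2)
    by (intro Cauchy_inequality)
       (auto intro: holomorphic_on_subset holomorphic_on_imp_continuous_on)
  then show ?thesis
    unfolding hom_comp_def by (simp add: norm_divide divide_le_eq mult.commute)
qed

lemma hom_comp_sums: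
  assumes "z \<in> G" "norm \<zeta> < 1"
  shows "(\<lambda>j. \<zeta> ^ j * hom_comp f j z) sums f (\<zeta> *s z)"
proof -
  have "(\<lambda>\<zeta>. f (\<zeta> *s z)) holomorphic_on ball 0 1"
    using holomorphic_on_subset[OF holo_radial] radial_disc[OF assms(1)] ball_subset_cball by blast
  from holomorphic_power_series[OF this, of \<zeta>] assms(2) show ?thesis
    by (simp add: hom_comp_def mult.commute)
qed

text \<open>All coefficients of the slice are at most \<open>B\<close>, so a geometric series
  majorizes the remainder.\<close>

lemma hom_comp_tail:
  assumes z: "z \<in> G" and B: "\<And>c. norm c = 1 \<Longrightarrow> norm (f (c *s z)) \<le> B" and \<zeta>: "norm \<zeta> < 1"
  shows "norm (f (\<zeta> *s z) - (\<Sum>i<k. \<zeta> ^ i * hom_comp f i z)) \<le> B * norm \<zeta> ^ k / (1 - norm \<zeta>)"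
proof (rule norm_sums_le)
  show "(\<lambda>i. \<zeta> ^ (i + k) * hom_comp f (i + k) z) sums
      (f (\<zeta> *s z) - (\<Sum>i<k. \<zeta> ^ i * hom_comp f i z))"
    using hom_comp_sums[OF z \<zeta>] by (rule sums_split_initial_segment)
  have "(\<lambda>i. B * norm \<zeta> ^ k * norm \<zeta> ^ i) sums (B * norm \<zeta> ^ k * (1 / (1 - norm \<zeta>)))"
    using \<zeta> by (intro sums_mult geometric_sums) auto
  then show "(\<lambda>i. B * norm \<zeta> ^ k * norm \<zeta> ^ i) sums (B * norm \<zeta> ^ k / (1 - norm \<zeta>))" by simp
  show "norm (\<zeta> ^ (i + k) * hom_comp f (i + k) z) \<le> B * norm \<zeta> ^ k * norm \<zeta> ^ i" for i
    using mult_left_mono[OF norm_hom_comp_le[OF z B, of "i + k"], of "norm \<zeta> ^ (i + k)"]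
    by (simp add: norm_mult norm_power power_add ac_simps)
qed

lemma hom_comp_scale:
  assumes "z \<in> G" "norm \<mu> \<le> 1"
  shows "hom_comp f j (\<mu> *s z) = \<mu> ^ j * hom_comp f j z"
proof -
  let ?T = "{\<zeta>. \<zeta> *s z \<in> G}" and ?S = "{\<zeta>. \<zeta> *s (\<mu> *s z) \<in> G}"
  have "0 \<in> ?S"
    using G(2) assms(1) unfolding balanced_def
    by (metis (no_types, lifting) mem_Collect_eq norm_zero vector_smult_lzero zero_le_one)
  then have "(deriv ^^ j) (\<lambda>w. f ((\<mu> * w) *s z)) 0 = \<mu> ^ j * (deriv ^^ j) (\<lambda>\<zeta>. f (\<zeta> *s z)) (\<mu> * 0)"
    using open_radial[of "\<mu> *s z"]
    by (intro higher_deriv_compose_linear[OF holo_radial, of ?S])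
       (auto simp: open_radial vector_smult_assoc mult.commute)
  then show ?thesis
    unfolding hom_comp_def by (simp add: vector_smult_assoc mult.commute)
qed

text \<open>The component of degree j is the limit, as t tends to 0, of f(t w) minus the lower
  components, divided by t^j. \<open>hom_comp_tail\<close> makes this limit uniform on the ball,
  where one bound of \<open>f\<close> serves all circles; holomorphy along lines then passes from
  the quotients, by induction on j, to the limit.\<close>

lemma hom_comp_line_holomorphic:
  assumes \<rho>: "cball 0 \<rho> \<subseteq> G"
  shows "(\<lambda>\<zeta>. hom_comp f j (z + \<zeta> *s v)) holomorphic_on {\<zeta>. z + \<zeta> *s v \<in> ball 0 \<rho>}"
proof (induction j rule: less_induct)
  case (less j)
  let ?U = "{\<zeta>. z + \<zeta> *s v \<in> ball 0 \<rho>}"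
  have U: "open ?U" by (intro open_cvec_line) simp
  have "compact (f ` cball 0 \<rho>)"
    using holo_continuous_on[OF f] \<rho> by (intro compact_continuous_image) (auto intro: continuous_on_subset)
  then obtain B where "0 < B" and B: "\<And>y. y \<in> cball 0 \<rho> \<Longrightarrow> norm (f y) \<le> B"
    using compact_imp_bounded bounded_pos by (metis imageI)
  \<comment> \<open>Any null sequence of non-zero numbers would do; the shift by 2 gives the bound
    1/2, hence the factor 2 in the error \<open>2 * B * norm (t n)\<close>.\<close>
  define t where "t n = complex_of_real (inverse (real (n + 2)))" for n
  have tn: "norm (t n) = inverse (real (n + 2))" for n
    unfolding t_def norm_of_real by simp
  have t: "t n \<noteq> 0" "norm (t n) \<le> 1 / 2" for n
  proof -
    have "norm (t n) > 0" unfolding tn by simp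
    then show "t n \<noteq> 0" by simp
    show "norm (t n) \<le> 1 / 2" unfolding tn by (simp add: field_simps)
  qed
  define q where "q n w = (f (t n *s w) - (\<Sum>i<j. t n ^ i * hom_comp f i w)) / t n ^ j" for n w
  have q: "norm (q n w - hom_comp f j w) \<le> 2 * B * norm (t n)" if "w \<in> ball 0 \<rho>" for n w
  proof -
    have w: "w \<in> G" using that \<rho> by auto
    have "norm (f (t n *s w) - (\<Sum>i<Suc j. t n ^ i * hom_comp f i w)) \<le>
        B * norm (t n) ^ Suc j / (1 - norm (t n))"
    proof (rule hom_comp_tail[OF w])
      show "norm (f (c *s w)) \<le> B" if "norm c = 1" for c
        using that \<open>w \<in> ball 0 \<rho>\<close> by (intro B) (simp add: norm_cvec_scale)
    qed (use t(2)[of n] in simp)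
    also have "\<dots> \<le> B * norm (t n) ^ Suc j / (1 / 2)"
      using t(2)[of n] \<open>0 < B\<close> by (intro divide_left_mono) auto
    finally have 1: "norm (f (t n *s w) - (\<Sum>i<Suc j. t n ^ i * hom_comp f i w)) \<le>
        2 * B * norm (t n) * norm (t n ^ j)" by (simp add: norm_power)
    have "q n w - hom_comp f j w = (f (t n *s w) - (\<Sum>i<Suc j. t n ^ i * hom_comp f i w)) / t n ^ j"
      unfolding q_def using t(1)[of n] by (simp add: field_simps)
    then show ?thesis using 1 t(1)[of n] by (simp add: norm_divide divide_le_eq)
  qed
  show ?case
  proof (rule holomorphic_uniform_sequence[OF U])
    show "(\<lambda>\<zeta>. q n (z + \<zeta> *s v)) holomorphic_on ?U" for n
      unfolding q_def
    proof (intro holomorphic_intros less.IH)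
      have eq: "t n *s z + \<zeta> *s (t n *s v) = t n *s (z + \<zeta> *s v)" for \<zeta>
        by (simp add: vector_add_ldistrib vector_smult_assoc mult.commute)
      have "t n *s w \<in> G" if "w \<in> ball 0 \<rho>" for w
      proof -
        have "w \<in> G" "norm (t n) \<le> 1" using subsetD[OF \<rho>, of w] that t(2)[of n] by auto
        then show ?thesis using G(2) unfolding balanced_def by blast
      qed
      then have "?U \<subseteq> {\<zeta>. t n *s (z + \<zeta> *s v) \<in> G}" by blast
      with holo_line[OF f, of "t n *s z" "t n *s v"]
      show "(\<lambda>\<zeta>. f (t n *s (z + \<zeta> *s v))) holomorphic_on ?U"
        unfolding eq by (rule holomorphic_on_subset)
    qed (auto simp: t)
    fix \<zeta> assume "\<zeta> \<in> ?U"
    then obtain d where d: "d > 0" "cball \<zeta> d \<subseteq> ?U" using U open_contains_cball by blast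
    have lim: "(\<lambda>n. 2 * B * norm (t n)) \<longlonglongrightarrow> 0"
      unfolding tn using tendsto_mult_right_zero[OF LIMSEQ_ignore_initial_segment[OF LIMSEQ_inverse_real_of_nat, of 1]]
      by (simp add: add.commute)
    have "uniform_limit (cball \<zeta> d) (\<lambda>n \<zeta>. q n (z + \<zeta> *s v)) (\<lambda>\<zeta>. hom_comp f j (z + \<zeta> *s v)) sequentially"
      unfolding uniform_limit_iff
    proof (intro allI impI)
      fix e :: real assume "e > 0"
      with lim have "\<forall>\<^sub>F n in sequentially. 2 * B * norm (t n) < e"
        by (rule order_tendstoD(2))
      then show "\<forall>\<^sub>F n in sequentially. \<forall>x\<in>cball \<zeta> d.
          dist (q n (z + x *s v)) (hom_comp f j (z + x *s v)) < e"
      proof eventually_elim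
        case (elim n)
        show ?case
        proof
          fix x assume "x \<in> cball \<zeta> d"
          then have "z + x *s v \<in> ball 0 \<rho>" using d(2) by blast
          from le_less_trans[OF q[OF this] elim]
          show "dist (q n (z + x *s v)) (hom_comp f j (z + x *s v)) < e" by (simp only: dist_norm)
        qed
      qed
    qed
    then show "\<exists>d>0. cball \<zeta> d \<subseteq> ?U \<and>
        uniform_limit (cball \<zeta> d) (\<lambda>n \<zeta>. q n (z + \<zeta> *s v)) (\<lambda>\<zeta>. hom_comp f j (z + \<zeta> *s v)) sequentially"
      using d by blast
  qed
qed

text \<open>Homogeneity extends the component from \<open>G\<close> to a function \<open>F\<close>
  on the whole space that is entire on every coordinate line. Its growth there is of order j, so
  Liouville's theorem gives a polynomial of degree at most j in each coordinate, and separate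
  polynomiality with a common degree bound suffices.\<close>

lemma hom_comp_polynomial:
  assumes "G \<noteq> {}"
  shows "\<exists>p. complex_polynomial p \<and> (\<forall>z\<in>G. hom_comp f j z = p z)"
proof -
  have "0 \<in> G"
    using assms G(2) unfolding balanced_def
    by (metis all_not_in_conv norm_zero vector_smult_lzero zero_le_one)
  then obtain \<rho> where "\<rho> > 0" and \<rho>: "cball 0 \<rho> \<subseteq> G"
    using G(1) open_contains_cball by blast
  have "compact (f ` cball 0 \<rho>)"
    using holo_continuous_on[OF f] \<rho> by (intro compact_continuous_image) (auto intro: continuous_on_subset)
  then obtain B where "0 < B" and B: "\<And>y. y \<in> cball 0 \<rho> \<Longrightarrow> norm (f y) \<le> B"
    using compact_imp_bounded bounded_pos by (metis imageI)
  \<comment> \<open>By homogeneity this does not depend on \<open>s\<close> as long as s z lies in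
    \<open>G\<close>; small \<open>s\<close> therefore gives a value at every
    \<open>z\<close>.\<close>
  define H where "H s z = hom_comp f j (of_real s *s z) / of_real s ^ j" for s :: real and z
  have H_le: "H u z = H s z" if "0 < u" "u \<le> s" "of_real s *s z \<in> G" for u s z
  proof -
    have "hom_comp f j (of_real (u / s) *s (of_real s *s z)) = of_real (u / s) ^ j * hom_comp f j (of_real s *s z)"
      using that by (intro hom_comp_scale) (auto simp: norm_divide)
    then show ?thesis
      using that by (simp add: H_def vector_smult_assoc power_divide)
  qed
  have H_eq: "H u z = H s z" if "0 < u" "0 < s" "of_real u *s z \<in> G" "of_real s *s z \<in> G" for u s z
    using H_le[of "min u s" u z] H_le[of "min u s" s z] that by simp
  \<comment> \<open>An explicit scale that moves \<open>z\<close> into the ball of radius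
    \<open>\<rho>\<close>. Its reciprocal grows linearly in the norm of \<open>z\<close>, which
    yields growth of order j for \<open>F\<close>.\<close>
  define t where "t z = \<rho> / 2 / (1 + norm z)" for z :: "complex^'d"
  have t: "0 < t z" for z unfolding t_def using \<open>\<rho> > 0\<close> by (simp add: add_pos_nonneg)
  have tG: "s * norm z < \<rho>" if "0 < s" "s \<le> t z" for s z
  proof -
    have "s * norm z \<le> t z * norm z" using that by (intro mult_right_mono) auto
    also have "t z * norm z = \<rho> / 2 - t z"
    proof -
      have "1 + norm z \<noteq> 0" using norm_ge_zero[of z] by linarith
      then have "t z * (1 + norm z) = \<rho> / 2" using t_def nonzero_eq_divide_eq by metis
      then show ?thesis by (simp add: algebra_simps)
    qed
    also have "\<dots> < \<rho>" using t[of z] \<open>\<rho> > 0\<close> by simp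
    finally show ?thesis .
  qed
  have tball: "of_real s *s z \<in> ball 0 \<rho>" if "0 < s" "s \<le> t z" for s z
    using tG[OF that] that by (simp add: norm_cvec_scale norm_of_real)
  have bG: "w \<in> G" if "w \<in> ball 0 \<rho>" for w using that \<rho> by auto
  define F where "F z = H (t z) z" for z
  have F_eq: "F z = H s z" if "0 < s" "of_real s *s z \<in> G" for s z
    unfolding F_def using that t tball bG by (intro H_eq) auto
  have F_bound: "norm (F z) \<le> B / t z ^ j" for z
  proof -
    have "norm (hom_comp f j (of_real (t z) *s z)) \<le> B"
    proof (rule norm_hom_comp_le[OF bG[OF tball[OF t order_refl]]])
      show "norm (f (c *s (of_real (t z) *s z))) \<le> B" if "norm c = 1" for c
        using tG[of "t z" z] t[of z] that by (intro B) (simp add: norm_cvec_scale norm_mult)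
    qed
    then show ?thesis
      using t[of z] by (simp add: F_def H_def norm_divide norm_power norm_of_real divide_right_mono)
  qed
  have "complex_polynomial F"
  proof (rule complex_polynomial_if_separately)
    fix z :: "complex^'d" and i
    define v :: "complex^'d" where "v = axis i 1"
    define z' where "z' = (\<chi> j. if j = i then 0 else z $ j)"
    have line: "(\<chi> j. if j = i then \<zeta> else z $ j) = z' + \<zeta> *s v" for \<zeta>
      by (auto simp: v_def z'_def axis_def vec_eq_iff)
    have nv: "norm v = 1" by (simp add: v_def)
    define h where "h \<zeta> = F (z' + \<zeta> *s v)" for \<zeta>
    have nl: "norm (z' + \<zeta> *s v) \<le> norm z' + norm \<zeta>" for \<zeta>
      using norm_triangle_ineq[of z' "\<zeta> *s v"] by (simp add: norm_cvec_scale nv)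
    \<comment> \<open>The scale in \<open>F\<close> varies with the point in a non-holomorphic way.
      On a bounded disc one constant scale \<open>s\<close> works for all points, and by
      \<open>F_eq\<close> it gives the same function.\<close>
    have "h holomorphic_on ball 0 R" if "R > 0" for R
    proof -
      define s where "s = \<rho> / 2 / (1 + (norm z' + R))"
      have "s > 0" using \<open>\<rho> > 0\<close> \<open>R > 0\<close> by (simp add: s_def add_pos_nonneg)
      have s: "of_real s *s (z' + \<zeta> *s v) \<in> ball 0 \<rho>" if "\<zeta> \<in> ball 0 R" for \<zeta>
      proof (rule tball[OF \<open>s > 0\<close>])
        show "s \<le> t (z' + \<zeta> *s v)"
          unfolding s_def t_def using nl[of \<zeta>] that \<open>\<rho> > 0\<close> \<open>R > 0\<close>
          by (intro divide_left_mono mult_pos_pos add_pos_nonneg) auto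
      qed
      have eq: "of_real s *s (z' + \<zeta> *s v) = of_real s *s z' + \<zeta> *s (of_real s *s v)" for \<zeta>
        by (simp add: vector_add_ldistrib vector_smult_assoc mult.commute)
      have "(\<lambda>\<zeta>. hom_comp f j (of_real s *s z' + \<zeta> *s (of_real s *s v)) / of_real s ^ j)
          holomorphic_on {\<zeta>. of_real s *s z' + \<zeta> *s (of_real s *s v) \<in> ball 0 \<rho>}"
        using \<open>s > 0\<close> by (intro holomorphic_intros hom_comp_line_holomorphic \<rho>) auto
      then have "(\<lambda>\<zeta>. H s (z' + \<zeta> *s v)) holomorphic_on ball 0 R"
        unfolding H_def eq[symmetric] using s by (rule_tac holomorphic_on_subset) auto
      moreover have "h \<zeta> = H s (z' + \<zeta> *s v)" if "\<zeta> \<in> ball 0 R" for \<zeta>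
        unfolding h_def using \<open>s > 0\<close> s[OF that] bG by (intro F_eq)
      ultimately show ?thesis by (metis (no_types, lifting) holomorphic_transform)
    qed
    then have "h holomorphic_on (\<Union>R\<in>{0<..}. ball 0 R)"
      by (intro holomorphic_on_UN_open) auto
    moreover have "\<zeta> \<in> (\<Union>R\<in>{0<..}. ball 0 R)" for \<zeta> :: complex
      by (rule UN_I[of "norm \<zeta> + 1"]) (auto intro: add_nonneg_pos)
    ultimately have hol: "h holomorphic_on UNIV" by (metis UNIV_eq_I)
    \<comment> \<open>The reciprocal of the scale is 2/\<rho> times 1 + |z' + \<zeta> v|, and the
      last factor is at most 2 |\<zeta>| for these \<zeta>; hence 4/\<rho>.\<close>
    have "norm (h \<zeta>) \<le> (B * (4 / \<rho>) ^ j) * norm \<zeta> ^ j" if "1 + norm z' \<le> norm \<zeta>" for \<zeta>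
    proof -
      have "norm (h \<zeta>) \<le> B / t (z' + \<zeta> *s v) ^ j" unfolding h_def by (rule F_bound)
      also have "\<dots> = B * (2 / \<rho> * (1 + norm (z' + \<zeta> *s v))) ^ j"
        using \<open>\<rho> > 0\<close> by (simp add: t_def power_divide power_mult_distrib field_simps)
      also have "\<dots> \<le> B * (2 / \<rho> * (2 * norm \<zeta>)) ^ j"
        using nl[of \<zeta>] that \<open>\<rho> > 0\<close> \<open>B > 0\<close>
        by (intro mult_left_mono power_mono mult_nonneg_nonneg add_nonneg_nonneg) auto
      also have "\<dots> = (B * (4 / \<rho>) ^ j) * norm \<zeta> ^ j"
        by (simp add: power_mult_distrib[symmetric])
      finally show ?thesis .
    qed
    from Liouville_polynomial[OF hol this]
    have hp: "h \<zeta> = (\<Sum>k\<le>j. (deriv ^^ k) h 0 / fact k * \<zeta> ^ k)" for \<zeta> by simp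
    define p where "p = (\<Sum>k\<le>j. monom ((deriv ^^ k) h 0 / fact k) k)"
    have "degree p \<le> j"
      unfolding p_def by (intro degree_sum_le order_trans[OF degree_monom_le]) auto
    moreover have "h \<zeta> = poly p \<zeta>" for \<zeta>
      by (subst hp) (simp add: p_def poly_sum poly_monom)
    ultimately show "\<exists>p. degree p \<le> j \<and> (\<forall>\<zeta>. F (\<chi> j. if j = i then \<zeta> else z $ j) = poly p \<zeta>)"
      unfolding line h_def by blast
  qed
  moreover have "hom_comp f j z = F z" if "z \<in> G" for z
    using F_eq[of 1 z] that by (simp add: H_def)
  ultimately show ?thesis by blast
qed

text \<open>The polynomials are Taylor sections of dilations of \<^term>\<open>f\<close>; a dilation \<open>f(r z)\<close> is bounded
  by the maximum of \<open>\<bar>f\<bar>\<close> on the circle through \<open>z\<close>, and so are its homogeneous components.\<close>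

lemma polynomial_approximation:
  assumes w: "w \<in> G" and "e > 0"
  shows "\<exists>p. complex_polynomial p \<and> norm (p w - f w) < e \<and>
    (\<forall>z\<in>G. \<forall>B. (\<forall>c. norm c = 1 \<longrightarrow> norm (f (c *s z)) \<le> B) \<longrightarrow> norm (p z) \<le> 2 * B)"
proof -
  have w1: "1 \<in> {\<zeta>. \<zeta> *s w \<in> G}" using w by simp
  have "isCont (\<lambda>\<zeta>. f (\<zeta> *s w)) 1"
    using holomorphic_on_imp_continuous_on[OF holo_radial] open_radial w1
    by (metis continuous_on_eq_continuous_at)
  then obtain d where d: "d > 0" "\<And>\<zeta>. norm (\<zeta> - 1) < d \<Longrightarrow> norm (f (\<zeta> *s w) - f w) < e / 2"
    unfolding continuous_at_eps_delta using \<open>e > 0\<close>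
    by (metis dist_norm half_gt_zero vector_smult_lid)
  \<comment> \<open>Close enough to 1 that the dilation costs less than e/2 at \<open>w\<close>, and
    positive because at most 1/2 is subtracted.\<close>
  define r where "r = 1 - min (d / 2) (1 / 2)"
  have r: "0 < r" "r < 1" "1 - r < d" unfolding r_def using d(1) by (auto simp: min_def)
  have "norm (of_real r - 1 :: complex) = 1 - r"
    using r(2) by (metis abs_minus_commute abs_of_pos diff_gt_0_iff_gt norm_of_real of_real_1 of_real_diff)
  then have fr: "norm (f (of_real r *s w) - f w) < e / 2" using d(2) r(3) by simp
  have "continuous_on (cball 0 1) (\<lambda>\<zeta>. f (\<zeta> *s w))"
    using holomorphic_on_imp_continuous_on[OF holo_radial] radial_disc[OF w] by (rule continuous_on_subset)
  then have "compact ((\<lambda>\<zeta>. f (\<zeta> *s w)) ` cball 0 1)" by (intro compact_continuous_image) auto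
  then obtain Bw where "0 < Bw" "\<And>y. y \<in> (\<lambda>\<zeta>. f (\<zeta> *s w)) ` cball 0 1 \<Longrightarrow> norm y \<le> Bw"
    using compact_imp_bounded bounded_pos by metis
  then have Bw: "norm (f (c *s w)) \<le> Bw" if "norm c = 1" for c using that by force
  \<comment> \<open>The first entry makes the remainder at most B on every circle with bound B,
    whatever \<open>z\<close> is; together with the bound of the dilation this is the factor 2. The
    second entry makes the remainder at \<open>w\<close> smaller than e/2.\<close>
  define m where "m = min (1 - r) (e / 2 * (1 - r) / Bw)"
  have "m > 0" unfolding m_def using r \<open>e > 0\<close> \<open>0 < Bw\<close> by simp
  then obtain k where "r ^ k < m" using real_arch_pow_inv r(2) by blast
  then have k: "r ^ k / (1 - r) \<le> 1" "Bw * (r ^ k / (1 - r)) < e / 2"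
    unfolding m_def using r \<open>0 < Bw\<close> by (auto simp: field_simps)
  obtain P where P: "\<And>j. complex_polynomial (P j)" "\<And>j z. z \<in> G \<Longrightarrow> hom_comp f j z = P j z"
    using hom_comp_polynomial w by (metis empty_iff)
  define p where "p z = (\<Sum>i<k. of_real r ^ i * P i z)" for z
  have tail: "norm (f (of_real r *s z) - p z) \<le> B * (r ^ k / (1 - r))"
    if "z \<in> G" "\<forall>c. norm c = 1 \<longrightarrow> norm (f (c *s z)) \<le> B" for z B
  proof -
    have "norm (of_real r :: complex) = r" using r by simp
    then show ?thesis
      using hom_comp_tail[of z B "of_real r" k] that r P(2) by (simp add: p_def)
  qed
  show ?thesis
  proof (intro exI conjI ballI allI impI)
    show "complex_polynomial p"
      unfolding p_def by (intro complex_polynomial_sum complex_polynomial_cmult P)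
    have "norm (p w - f w) \<le> norm (f (of_real r *s w) - p w) + norm (f (of_real r *s w) - f w)"
      using norm_triangle_ineq4[of "f (of_real r *s w) - f w" "f (of_real r *s w) - p w"]
      by (simp add: algebra_simps)
    also have "\<dots> < e / 2 + e / 2"
      using Bw by (intro add_strict_mono fr le_less_trans[OF tail[OF w] k(2)]) blast
    finally show "norm (p w - f w) < e" by simp
    fix z B assume z: "z \<in> G" and B: "\<forall>c. norm c = 1 \<longrightarrow> norm (f (c *s z)) \<le> B"
    have "norm (f (1 *s z)) \<le> B" using B norm_one by blast
    then have "0 \<le> B" using norm_ge_zero order_trans by blast
    have "norm (f (of_real r *s z)) \<le> B"
    proof (rule maximum_modulus_frontier[of "\<lambda>\<zeta>. f (\<zeta> *s z)" "cball 0 1"])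
      have h: "(\<lambda>\<zeta>. f (\<zeta> *s z)) holomorphic_on cball 0 1"
        using holo_radial radial_disc[OF z] by (rule holomorphic_on_subset)
      then show "(\<lambda>\<zeta>. f (\<zeta> *s z)) holomorphic_on interior (cball 0 1)"
        by (rule holomorphic_on_subset) auto
      show "continuous_on (closure (cball 0 1)) (\<lambda>\<zeta>. f (\<zeta> *s z))"
        using holomorphic_on_imp_continuous_on[OF h] by simp
    qed (use B r in auto)
    then have "norm (p z) \<le> B + B * (r ^ k / (1 - r))"
      using tail[OF z B] norm_triangle_sub[of "p z" "f (of_real r *s z)"]
      by (simp add: norm_minus_commute)
    also have "B * (r ^ k / (1 - r)) \<le> B * 1" using k(1) \<open>0 \<le> B\<close> by (rule mult_left_mono)
    finally show "norm (p z) \<le> 2 * B" by simp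
  qed
qed

end

section \<open>Completeness of the weighted spaces\<close>

lemma holo_add:
  assumes "f \<in> holo G" "g \<in> holo G" shows "(\<lambda>z. f z + g z) \<in> holo G"
proof -
  have "\<exists>D. ((\<lambda>z. f z + g z) has_derivative D) (at z) \<and> (\<forall>b v. D (b *s v) = b * D v)" if z: "z \<in> G" for z
  proof -
    obtain D where D: "(f has_derivative D) (at z)" "\<And>b v. D (b *s v) = b * D v"
      using assms(1) z unfolding holo_def by blast
    obtain E where E: "(g has_derivative E) (at z)" "\<And>b v. E (b *s v) = b * E v"
      using assms(2) z unfolding holo_def by blast
    show ?thesis
      by (intro exI[of _ "\<lambda>h. D h + E h"] conjI has_derivative_add D E) (simp add: D E distrib_left)
  qed
  then show ?thesis using assms unfolding holo_def by simp
qed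

lemma holo_cmult:
  assumes "f \<in> holo G" shows "(\<lambda>z. c * f z) \<in> holo G"
proof -
  have "\<exists>D. ((\<lambda>z. c * f z) has_derivative D) (at z) \<and> (\<forall>b v. D (b *s v) = b * D v)" if z: "z \<in> G" for z
  proof -
    obtain D where D: "(f has_derivative D) (at z)" "\<And>b v. D (b *s v) = b * D v"
      using assms z unfolding holo_def by blast
    show ?thesis
      by (intro exI[of _ "\<lambda>h. c * D h"] conjI has_derivative_mult_right D) (simp add: D mult.left_commute)
  qed
  then show ?thesis using assms unfolding holo_def by simp
qed

lemma holo_diff:
  assumes "f \<in> holo G" "g \<in> holo G" shows "(\<lambda>z. f z - g z) \<in> holo G"
  using holo_add[OF assms(1) holo_cmult[OF assms(2), of "-1"]] by simp

text \<open>Cauchy's inequality for the slice in direction \<open>v\<close>: the disc of radius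
  r/|v| is mapped into \<open>cball x r\<close>.\<close>

lemma holo_derivative_bound:
  fixes h :: "complex^'d \<Rightarrow> complex"
  assumes h: "h \<in> holo G" and r: "r > 0" "cball x r \<subseteq> G"
    and B: "\<And>y. y \<in> cball x r \<Longrightarrow> norm (h y) \<le> B"
    and D: "(h has_derivative D) (at x)" "\<And>c v. D (c *s v) = c * D v"
  shows "norm (D v) \<le> B / r * norm v"
proof (cases "v = 0")
  case True
  have "D 0 = 0" using D(2)[of 0 0] by simp
  then show ?thesis using True by simp
next
  case False
  let ?g = "\<lambda>\<zeta>. h (x + \<zeta> *s v)"
  let ?\<rho> = "r / norm v"
  have mem: "x + \<zeta> *s v \<in> cball x r" if "norm \<zeta> \<le> ?\<rho>" for \<zeta>
    using that False by (simp add: dist_norm norm_cvec_scale field_simps)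
  have "cball 0 ?\<rho> \<subseteq> {\<zeta>. x + \<zeta> *s v \<in> G}" using mem r(2) by auto
  then have hol: "?g holomorphic_on cball 0 ?\<rho>"
    using holo_line[OF h] by (rule_tac holomorphic_on_subset)
  have "deriv ?g 0 = D v"
    using has_field_derivative_line[of h D x 0 v] D by (intro DERIV_imp_deriv) simp
  moreover have "norm ((deriv ^^ 1) ?g 0) \<le> fact 1 * B / ?\<rho> ^ 1"
  proof (rule Cauchy_inequality)
    show "norm (?g \<zeta>) \<le> B" if "norm (0 - \<zeta>) = ?\<rho>" for \<zeta>
      using that by (intro B mem) simp
    show "0 < ?\<rho>" using r(1) False by simp
  qed (use hol in \<open>auto intro: holomorphic_on_subset holomorphic_on_imp_continuous_on\<close>)
  ultimately show ?thesis by simp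
qed

text \<open>Weierstrass' theorem. The Cauchy estimate for differences makes the derivatives
  uniformly Cauchy near each point, so the sequence can be differentiated termwise; complex
  homogeneity passes to the limit of the derivatives.\<close>

lemma holo_uniform_limit:
  fixes f :: "nat \<Rightarrow> complex^'d \<Rightarrow> complex"
  assumes "open G" and f: "\<And>n. f n \<in> holo G" and g0: "\<And>z. z \<notin> G \<Longrightarrow> g z = 0"
    and lim: "\<And>K. compact K \<Longrightarrow> K \<subseteq> G \<Longrightarrow> uniform_limit K f g sequentially"
  shows "g \<in> holo G"
proof -
  have "\<exists>g'. (g has_derivative g') (at z) \<and> (\<forall>c v. g' (c *s v) = c * g' v)" if "z \<in> G" for z
  proof -
    obtain s where s: "s > 0" "cball z s \<subseteq> G"
      using \<open>open G\<close> \<open>z \<in> G\<close> open_contains_cball by blast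
    \<comment> \<open>Half the radius leaves room for a Cauchy estimate: balls of radius
      \<open>r\<close> about points of \<open>ball z r\<close> stay in the compact ball on which
      convergence is uniform.\<close>
    define r where "r = s / 2"
    have r: "r > 0" "cball z (2 * r) \<subseteq> G" using s by (auto simp: r_def)
    have sub: "cball x r \<subseteq> cball z (2 * r)" if "x \<in> ball z r" for x
    proof
      fix y assume "y \<in> cball x r"
      then show "y \<in> cball z (2 * r)" using that dist_triangle[of z y x] by simp
    qed
    have ballG: "x \<in> G" if "x \<in> ball z r" for x
    proof (rule subsetD[OF r(2)])
      show "x \<in> cball z (2 * r)" using that r(1) by simp
    qed
    have "\<forall>n. \<forall>x\<in>G. \<exists>D. (f n has_derivative D) (at x) \<and> (\<forall>c v. D (c *s v) = c * D v)"
      using f unfolding holo_def by blast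
    then obtain D where D: "\<And>n x. x \<in> G \<Longrightarrow> (f n has_derivative D n x) (at x)"
        "\<And>n x c v. x \<in> G \<Longrightarrow> D n x (c *s v) = c * D n x v"
      by metis
    have cau: "\<exists>N. \<forall>n\<ge>N. \<forall>m\<ge>N. \<forall>x\<in>ball z r. \<forall>v. norm (D n x v - D m x v) \<le> e * norm v"
      if e: "e > 0" for e
    proof -
      have "uniformly_convergent_on (cball z (2 * r)) f"
        using lim[of "cball z (2 * r)"] r(2) unfolding uniformly_convergent_on_def by auto
      then have "uniformly_Cauchy_on (cball z (2 * r)) f"
        by (simp add: uniformly_convergent_eq_Cauchy)
      then obtain N where N: "\<And>x m n. x \<in> cball z (2 * r) \<Longrightarrow> m \<ge> N \<Longrightarrow> n \<ge> N \<Longrightarrow>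
          dist (f m x) (f n x) < e * r"
        using mult_pos_pos[OF e r(1)] unfolding uniformly_Cauchy_on_def by meson
      show ?thesis
      proof (intro exI allI ballI impI)
        fix n m x v assume nm: "n \<ge> N" "m \<ge> N" and x: "x \<in> ball z r"
        have "norm (D n x v - D m x v) \<le> e * r / r * norm v"
        proof (rule holo_derivative_bound[of "\<lambda>y. f n y - f m y" G r x])
          show "norm (f n y - f m y) \<le> e * r" if "y \<in> cball x r" for y
            using N[of y n m] that sub[OF x] nm by (auto simp: dist_norm less_imp_le)
          show "((\<lambda>y. f n y - f m y) has_derivative (\<lambda>v. D n x v - D m x v)) (at x)"
            by (intro has_derivative_diff D ballG x)
        qed (use f r sub[OF x] D(2)[OF ballG[OF x]] in \<open>auto intro: holo_diff simp: algebra_simps\<close>)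
        then show "norm (D n x v - D m x v) \<le> e * norm v" using r(1) by simp
      qed
    qed
    define g' where "g' x v = lim (\<lambda>n. D n x v)" for x v
    have g': "(\<lambda>n. D n x v) \<longlonglongrightarrow> g' x v" if "x \<in> ball z r" for x v
    proof -
      have "Cauchy (\<lambda>n. D n x v)"
      proof (rule metric_CauchyI)
        fix e :: real assume "e > 0"
        have v: "norm v < norm v + 1" "0 < norm v + 1" by (auto intro: add_nonneg_pos)
        obtain N where N: "\<And>n m. n \<ge> N \<Longrightarrow> m \<ge> N \<Longrightarrow> norm (D n x v - D m x v) \<le> e / (norm v + 1) * norm v"
          using cau[of "e / (norm v + 1)"] \<open>e > 0\<close> v \<open>x \<in> ball z r\<close> by (meson divide_pos_pos)
        have "e / (norm v + 1) * norm v < e" using v \<open>e > 0\<close> by (simp add: divide_less_eq algebra_simps)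
        then show "\<exists>N. \<forall>m\<ge>N. \<forall>n\<ge>N. dist (D m x v) (D n x v) < e"
          unfolding dist_norm using N le_less_trans by blast
      qed
      then show ?thesis unfolding g'_def using Cauchy_convergent convergent_LIMSEQ_iff by blast
    qed
    have zr: "z \<in> ball z r" using r(1) by simp
    have "\<exists>h. \<forall>x\<in>ball z r. (\<lambda>n. f n x) \<longlonglongrightarrow> h x \<and> (h has_derivative g' x) (at x within ball z r)"
    proof (rule has_derivative_sequence[of "ball z r" f D g' z])
      show "(f n has_derivative D n x) (at x within ball z r)" if "x \<in> ball z r" for n x
        by (rule has_derivative_at_withinI[OF D(1)[OF ballG[OF that]]])
      show "\<forall>\<^sub>F n in sequentially. \<forall>x\<in>ball z r. \<forall>v. norm (D n x v - g' x v) \<le> e * norm v"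
        if e: "e > 0" for e
      proof -
        obtain N where N: "\<And>n m x v. n \<ge> N \<Longrightarrow> m \<ge> N \<Longrightarrow> x \<in> ball z r \<Longrightarrow>
            norm (D n x v - D m x v) \<le> e * norm v"
          using cau[OF e] by blast
        have "norm (D n x v - g' x v) \<le> e * norm v" if "n \<ge> N" "x \<in> ball z r" for n x v
        proof (rule tendsto_upperbound)
          show "(\<lambda>m. norm (D n x v - D m x v)) \<longlonglongrightarrow> norm (D n x v - g' x v)"
            by (intro tendsto_intros g' that)
          show "\<forall>\<^sub>F m in sequentially. norm (D n x v - D m x v) \<le> e * norm v"
            using N[OF that(1) _ that(2)] by (rule eventually_sequentiallyI[of N])
        qed simp
        then show ?thesis unfolding eventually_sequentially by blast
      qed
      show "(\<lambda>n. f n z) \<longlonglongrightarrow> g z"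
        using lim[of "{z}"] \<open>z \<in> G\<close> by (simp add: tendsto_uniform_limitI)
    qed (use zr in auto)
    then obtain h where h: "\<And>x. x \<in> ball z r \<Longrightarrow> (\<lambda>n. f n x) \<longlonglongrightarrow> h x"
        "\<And>x. x \<in> ball z r \<Longrightarrow> (h has_derivative g' x) (at x within ball z r)" by blast
    have "h x = g x" if "x \<in> ball z r" for x
    proof -
      from ballG[OF that] have "(\<lambda>n. f n x) \<longlonglongrightarrow> g x" using lim[of "{x}"] by (simp add: tendsto_uniform_limitI)
      then show ?thesis using h(1)[OF that] LIMSEQ_unique by blast
    qed
    moreover have "(h has_derivative g' z) (at z)"
      using h(2)[OF zr] at_within_open[OF zr] by simp
    ultimately have "(g has_derivative g' z) (at z)"
      using has_derivative_transform_within_open[OF _ open_ball zr] by blast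
    moreover have "g' z (c *s v) = c * g' z v" for c v
    proof (rule LIMSEQ_unique)
      show "(\<lambda>n. D n z (c *s v)) \<longlonglongrightarrow> g' z (c *s v)" by (rule g'[OF zr])
      show "(\<lambda>n. D n z (c *s v)) \<longlonglongrightarrow> c * g' z v"
        unfolding D(2)[OF \<open>z \<in> G\<close>] by (intro tendsto_mult_left g' zr)
    qed
    ultimately show ?thesis by blast
  qed
  then show ?thesis unfolding holo_def using g0 by blast
qed

lemma weight_pos: "weight G a \<Longrightarrow> z \<in> G \<Longrightarrow> 0 < a z"
  unfolding weight_def by blast

lemma Ha0_set_subset_Ha_set:
  assumes a: "weight G a" shows "Ha0_set G a \<subseteq> Ha_set G a"
proof
  fix f assume f: "f \<in> Ha0_set G a"
  then have "\<exists>K. compact K \<and> K \<subseteq> G \<and> (\<forall>z\<in>G - K. \<bar>a z * norm (f z)\<bar> < 1)"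
    unfolding Ha0_set_def vanishes_at_inf_on_def by simp
  then obtain K where K: "compact K" "K \<subseteq> G" "\<And>z. z \<in> G - K \<Longrightarrow> \<bar>a z * norm (f z)\<bar> < 1"
    by blast
  have fh: "f \<in> holo G" using f by (simp add: Ha0_set_def)
  have "continuous_on K (\<lambda>z. a z * norm (f z))"
    using a K(2) holo_continuous_on[OF fh] unfolding weight_def
    by (intro continuous_intros) (auto intro: continuous_on_subset)
  then have "bdd_above ((\<lambda>z. a z * norm (f z)) ` K)"
    by (intro bounded_imp_bdd_above compact_imp_bounded compact_continuous_image K(1))
  then obtain B where B: "\<And>z. z \<in> K \<Longrightarrow> a z * norm (f z) \<le> B"
    unfolding bdd_above_def by blast
  have "a z * norm (f z) \<le> max 1 B" if "z \<in> G" for z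
    using that K(3)[of z] B[of z] by (cases "z \<in> K") auto
  then show "f \<in> Ha_set G a" unfolding Ha_set_def using fh by (auto intro!: bdd_aboveI2)
qed

text \<open>A weight has a positive minimum on a non-empty compact set, so convergence in the
  weighted norm is locally uniform and Weierstrass' theorem applies; vanishing at infinity is
  inherited from a single close member of the sequence.\<close>

lemma Ha0_set_limit:
  fixes f :: "nat \<Rightarrow> complex^'d \<Rightarrow> complex"
  assumes G: "open G" and a: "weight G a" and f: "\<And>n. f n \<in> Ha0_set G a"
    and g0: "\<And>z. z \<notin> G \<Longrightarrow> g z = 0"
    and lim: "\<And>e. e > 0 \<Longrightarrow> \<forall>\<^sub>F n in sequentially. \<forall>z\<in>G. a z * norm (f n z - g z) \<le> e"
  shows "g \<in> Ha0_set G a"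
proof -
  have "g \<in> holo G"
  proof (rule holo_uniform_limit[OF G])
    show "f n \<in> holo G" for n using f by (simp add: Ha0_set_def)
    fix K assume K: "compact K" "K \<subseteq> G"
    show "uniform_limit K f g sequentially"
    proof (cases "K = {}")
      case False
      have "continuous_on K a" using a K(2) continuous_on_subset unfolding weight_def by blast
      then obtain y where y: "y \<in> K" "\<And>z. z \<in> K \<Longrightarrow> a y \<le> a z"
        using continuous_attains_inf[OF K(1) False] by blast
      have ay: "a y > 0" using weight_pos[OF a] y(1) K(2) by blast
      show ?thesis
        unfolding uniform_limit_iff
      proof (intro allI impI)
        fix e :: real assume "e > 0"
        then have "\<forall>\<^sub>F n in sequentially. \<forall>z\<in>G. a z * norm (f n z - g z) \<le> a y * (e / 2)"
          using ay by (intro lim) simp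
        then show "\<forall>\<^sub>F n in sequentially. \<forall>z\<in>K. dist (f n z) (g z) < e"
        proof eventually_elim
          case (elim n)
          show ?case
          proof
            fix z assume z: "z \<in> K"
            have "a y * norm (f n z - g z) \<le> a z * norm (f n z - g z)"
              using y(2)[OF z] by (intro mult_right_mono) auto
            also have "\<dots> \<le> a y * (e / 2)" using elim z K(2) by blast
            finally have "norm (f n z - g z) \<le> e / 2" using ay by simp
            then show "dist (f n z) (g z) < e" using \<open>e > 0\<close> by (simp add: dist_norm)
          qed
        qed
      qed
    qed (simp add: uniform_limit_iff)
  qed (rule g0)
  moreover have "vanishes_at_inf_on G (\<lambda>z. a z * norm (g z))"
    unfolding vanishes_at_inf_on_def
  proof (intro allI impI)
    fix e :: real assume "e > 0"
    then have "\<exists>n. \<forall>z\<in>G. a z * norm (f n z - g z) \<le> e / 2"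
      using eventually_happens'[OF sequentially_bot lim[of "e / 2"]] by simp
    then obtain n where n: "\<And>z. z \<in> G \<Longrightarrow> a z * norm (f n z - g z) \<le> e / 2" by blast
    have "vanishes_at_inf_on G (\<lambda>z. a z * norm (f n z))" using f[of n] by (simp add: Ha0_set_def)
    from this[unfolded vanishes_at_inf_on_def, rule_format, of "e / 2"] \<open>e > 0\<close>
    obtain K where K: "compact K" "K \<subseteq> G" "\<And>z. z \<in> G - K \<Longrightarrow> \<bar>a z * norm (f n z)\<bar> < e / 2"
      by auto
    have "\<bar>a z * norm (g z)\<bar> < e" if z: "z \<in> G - K" for z
    proof -
      have "a z * norm (g z) \<le> a z * (norm (f n z) + norm (f n z - g z))"
        using norm_triangle_sub[of "g z" "f n z"] weight_pos[OF a, of z] z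
        by (intro mult_left_mono) (auto simp: norm_minus_commute)
      also have "\<dots> < e" using n[of z] K(3)[OF z] z by (simp add: distrib_left)
      finally show ?thesis using weight_pos[OF a, of z] z by simp
    qed
    then show "\<exists>K. compact K \<and> K \<subseteq> G \<and> (\<forall>z\<in>G - K. \<bar>a z * norm (g z)\<bar> < e)" using K by blast
  qed
  ultimately show ?thesis unfolding Ha0_set_def by simp
qed

section \<open>Growth functions and polynomial approximation in the weighted spaces\<close>

lemma assoc_growth_upper:
  assumes "g \<in> holo G" "\<And>x. x \<in> G \<Longrightarrow> norm (g x) \<le> w x" "z \<in> G"
  shows "norm (g z) \<le> assoc_growth G w z"
  unfolding assoc_growth_def using assms by (intro cSup_upper) (auto intro!: bdd_aboveI[of _ "w z"])

lemma zero_holo: "(\<lambda>x. 0) \<in> holo G"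
  unfolding holo_def by (auto intro!: exI[of _ "\<lambda>_. 0"])

lemma less_assoc_growthE:
  assumes "C < assoc_growth G w z" "\<And>x. x \<in> G \<Longrightarrow> 0 \<le> w x"
  obtains g where "g \<in> holo G" "\<And>x. x \<in> G \<Longrightarrow> norm (g x) \<le> w x" "C < norm (g z)"
proof -
  let ?S = "{norm (g z) |g. g \<in> holo G \<and> (\<forall>x\<in>G. norm (g x) \<le> w x)}"
  have "norm (0::complex) \<in> ?S"
    by (rule CollectI, rule exI[of _ "\<lambda>_. 0"]) (simp add: zero_holo assms(2))
  then have "?S \<noteq> {}" by (metis empty_iff)
  from less_cSupD[OF this assms(1)[unfolded assoc_growth_def]]
  obtain y where "y \<in> ?S" "C < y" by (rule bexE)
  then show ?thesis using that by (elim CollectE exE conjE) simp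
qed

lemma Ha0_set_add:
  assumes a: "weight G a" and f: "f \<in> Ha0_set G a" and g: "g \<in> Ha0_set G a"
  shows "(\<lambda>z. f z + g z) \<in> Ha0_set G a"
proof -
  have "vanishes_at_inf_on G (\<lambda>z. a z * norm (f z + g z))"
    unfolding vanishes_at_inf_on_def
  proof (intro allI impI)
    fix e :: real assume e: "e > 0"
    have "vanishes_at_inf_on G (\<lambda>z. a z * norm (f z))" "vanishes_at_inf_on G (\<lambda>z. a z * norm (g z))"
      using f g by (auto simp: Ha0_set_def)
    note v = this[unfolded vanishes_at_inf_on_def, rule_format, of "e / 2"]
    obtain K where K: "compact K" "K \<subseteq> G" "\<And>z. z \<in> G - K \<Longrightarrow> \<bar>a z * norm (f z)\<bar> < e / 2"
      using v(1) e by auto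
    obtain L where L: "compact L" "L \<subseteq> G" "\<And>z. z \<in> G - L \<Longrightarrow> \<bar>a z * norm (g z)\<bar> < e / 2"
      using v(2) e by auto
    have "\<bar>a z * norm (f z + g z)\<bar> < e" if z: "z \<in> G - (K \<union> L)" for z
    proof -
      have az: "a z > 0" using weight_pos[OF a] z by blast
      have "a z * norm (f z + g z) \<le> a z * (norm (f z) + norm (g z))"
        using az by (intro mult_left_mono norm_triangle_ineq) simp
      also have "\<dots> < e" using K(3)[of z] L(3)[of z] z by (simp add: distrib_left)
      finally show ?thesis using az by simp
    qed
    then show "\<exists>K. compact K \<and> K \<subseteq> G \<and> (\<forall>z\<in>G - K. \<bar>a z * norm (f z + g z)\<bar> < e)"
      using K(1,2) L(1,2) by (intro exI[of _ "K \<union> L"]) auto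
  qed
  then show ?thesis using f g holo_add unfolding Ha0_set_def by blast
qed

lemma Ha0_set_cmult:
  assumes f: "f \<in> Ha0_set G a"
  shows "(\<lambda>z. c * f z) \<in> Ha0_set G a"
proof -
  have "vanishes_at_inf_on G (\<lambda>z. a z * norm (c * f z))"
    unfolding vanishes_at_inf_on_def
  proof (intro allI impI)
    fix e :: real assume e: "e > 0"
    have c: "0 < norm c + 1" by (simp add: add_nonneg_pos)
    have "vanishes_at_inf_on G (\<lambda>z. a z * norm (f z))" using f by (auto simp: Ha0_set_def)
    from this[unfolded vanishes_at_inf_on_def, rule_format, of "e / (norm c + 1)"]
    obtain K where K: "compact K" "K \<subseteq> G" "\<And>z. z \<in> G - K \<Longrightarrow> \<bar>a z * norm (f z)\<bar> < e / (norm c + 1)"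
      using e c by auto
    have "\<bar>a z * norm (c * f z)\<bar> < e" if z: "z \<in> G - K" for z
    proof -
      have "\<bar>a z * norm (c * f z)\<bar> \<le> (norm c + 1) * \<bar>a z * norm (f z)\<bar>"
        by (simp add: norm_mult abs_mult algebra_simps)
      also have "\<dots> < e" using K(3)[OF z] c by (simp add: less_divide_eq mult.commute)
      finally show ?thesis .
    qed
    then show "\<exists>K. compact K \<and> K \<subseteq> G \<and> (\<forall>z\<in>G - K. \<bar>a z * norm (c * f z)\<bar> < e)"
      using K(1,2) by blast
  qed
  then show ?thesis using f holo_cmult unfolding Ha0_set_def by blast
qed

lemma Ha_set_bound:
  assumes "f \<in> Ha_set G a"
  shows "\<exists>C>0. \<forall>z\<in>G. a z * norm (f z) \<le> C"
proof -
  from assms have "bdd_above ((\<lambda>z. a z * norm (f z)) ` G)" unfolding Ha_set_def by simp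
  then obtain C where "\<And>z. z \<in> G \<Longrightarrow> a z * norm (f z) \<le> C" unfolding bdd_above_def by blast
  then have "\<And>z. z \<in> G \<Longrightarrow> a z * norm (f z) \<le> max C 1" by (simp add: max.coboundedI1)
  then show ?thesis by (intro exI[of _ "max C 1"]) simp
qed

section \<open>Weights in the balanced setting\<close>

locale balanced_weights =
  fixes G :: "(complex^'d) set" and A :: "nat \<Rightarrow> nat \<Rightarrow> complex^'d \<Rightarrow> real"
  assumes G: "open G" "G \<noteq> {}" and ws: "weight_system G A" and bs: "balanced_setting G A"
begin

lemma wA: "weight G (A N n)"
  using ws unfolding weight_system_def by blast

lemma A_pos: "z \<in> G \<Longrightarrow> 0 < A N n z"
  using weight_pos[OF wA] .

lemma A_mono_left: "M \<le> N \<Longrightarrow> z \<in> G \<Longrightarrow> A M n z \<le> A N n z"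
  using ws by (rule_tac lift_Suc_mono_le[of "\<lambda>N. A N n z"]) (auto simp: weight_system_def)

lemma A_antimono_right: "m \<le> n \<Longrightarrow> z \<in> G \<Longrightarrow> A N n z \<le> A N m z"
  using ws by (rule_tac lift_Suc_antimono_le[of "\<lambda>n. A N n z"]) (auto simp: weight_system_def)

lemma polynomial_in_Ha0_set:
  "complex_polynomial p \<Longrightarrow> (\<lambda>z. if z \<in> G then p z else 0) \<in> Ha0_set G (A N n)"
  using bs unfolding balanced_setting_def by blast

text \<open>The constant 1 is a polynomial and so has finite weighted norm.\<close>

lemma A_bounded: "\<exists>C. \<forall>z\<in>G. A N n z \<le> C"
proof -
  have "(\<lambda>z. if z \<in> G then 1 else 0) \<in> Ha_set G (A N n)"
    using polynomial_in_Ha0_set[OF complex_polynomial_const[of 1]] Ha0_set_subset_Ha_set[OF wA]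
    by blast
  then obtain C where "\<And>z. z \<in> G \<Longrightarrow> A N n z * norm (if z \<in> G then 1 else 0 :: complex) \<le> C"
    using Ha_set_bound by blast
  then show ?thesis by auto
qed

text \<open>The constant 1/C competes in the supremum. The weight is arbitrary because the maxima of
  weights in (B) are needed too; positivity makes the reciprocal in \<open>assoc_weight\<close> a
  genuine one.\<close>

lemma assoc_growth_pos:
  assumes "z \<in> G" and C: "\<And>x. x \<in> G \<Longrightarrow> a x \<le> C" and pos: "\<And>x. x \<in> G \<Longrightarrow> 0 < a x"
  shows "0 < assoc_growth G (\<lambda>x. 1 / a x) z"
proof -
  have C0: "C > 0" using assms by (metis less_le_trans)
  define g where "g x = (if x \<in> G then complex_of_real (1 / C) else 0)" for x
  have "g \<in> holo G"
    using polynomial_in_Ha0_set[OF complex_polynomial_const[of "complex_of_real (1 / C)"], of 0 0]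
    unfolding Ha0_set_def g_def by blast
  moreover have "norm (g x) \<le> 1 / a x" if "x \<in> G" for x
    using C[OF that] pos[OF that] C0 that by (simp add: g_def norm_divide frac_le)
  ultimately have "norm (g z) \<le> assoc_growth G (\<lambda>x. 1 / a x) z"
    using \<open>z \<in> G\<close> by (intro assoc_growth_upper)
  moreover have "norm (g z) > 0" using C0 \<open>z \<in> G\<close> by (simp add: g_def)
  ultimately show ?thesis by linarith
qed

lemma assoc_growth_A_pos: "z \<in> G \<Longrightarrow> 0 < assoc_growth G (\<lambda>x. 1 / A N n x) z"
proof -
  assume z: "z \<in> G"
  obtain C where "\<forall>x\<in>G. A N n x \<le> C" using A_bounded by blast
  then show ?thesis by (intro assoc_growth_pos[OF z, of _ C] A_pos) auto
qed

text \<open>For a radial weight, a|f| \<le> C bounds f by C / a(z) on the whole circle through z,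
  which is the kind of bound that the polynomial inherits up to the factor 2. One \<open>P\<close>
  serves all radial weights and all bounds at once.\<close>

lemma weighted_polynomial_approximation:
  assumes f: "f \<in> holo G" and w: "w \<in> G" and e: "e > 0"
  shows "\<exists>P. (\<forall>N n. P \<in> Ha0_set G (A N n)) \<and> norm (P w - f w) < e \<and>
    (\<forall>a C. radial G a \<longrightarrow> (\<forall>x\<in>G. 0 < a x) \<longrightarrow> (\<forall>x\<in>G. a x * norm (f x) \<le> C) \<longrightarrow>
      (\<forall>z\<in>G. a z * norm (P z) \<le> 2 * C))"
proof -
  have bal: "balanced G" using bs unfolding balanced_setting_def by blast
  obtain p where p: "complex_polynomial p" "norm (p w - f w) < e"
      "\<And>z B. z \<in> G \<Longrightarrow> (\<forall>c. norm c = 1 \<longrightarrow> norm (f (c *s z)) \<le> B) \<Longrightarrow> norm (p z) \<le> 2 * B"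
    using polynomial_approximation[OF G(1) bal f w e] by blast
  show ?thesis
  proof (intro exI[of _ "\<lambda>z. if z \<in> G then p z else 0"] conjI allI impI ballI)
    fix a C z
    assume a: "radial G a" "\<forall>x\<in>G. 0 < a x" "\<forall>x\<in>G. a x * norm (f x) \<le> C"
      and z: "z \<in> G"
    have "norm (p z) \<le> 2 * (C / a z)"
    proof (rule p(3)[OF z], intro allI impI)
      fix c :: complex assume c: "norm c = 1"
      then have "c *s z \<in> G" using bal z unfolding balanced_def by simp
      then have "a z * norm (f (c *s z)) \<le> C" using a(1,3) c z unfolding radial_def by metis
      then show "norm (f (c *s z)) \<le> C / a z" using bspec[OF a(2) z] by (simp add: le_divide_eq mult.commute)
    qed
    then show "a z * norm (if z \<in> G then p z else 0) \<le> 2 * C"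
      using bspec[OF a(2) z] z by (simp add: le_divide_eq mult.commute)
  qed (use p w polynomial_in_Ha0_set in auto)
qed

lemma radial_A: "radial G (A N n)"
  using bs unfolding balanced_setting_def by blast

section \<open>Condition (B)\<close>

text \<open>Passing to reciprocals, some \<open>g\<close> below 1/b exceeds at \<open>z\<close> the
  growth function of \<open>A M m\<close> by more than the factor \<open>c\<close>. Then g/c cannot
  be a competitor for that growth function, so the weighted modulus of \<open>g\<close> exceeds
  \<open>c\<close> somewhere, and approximation at that point gives the hump.\<close>

lemma unbounded_polynomial:
  fixes n :: "nat \<Rightarrow> nat"
  defines "b \<equiv> \<lambda>L x. Max ((\<lambda>N. A N (n N) x) ` {..L})"
  assumes "c > 0" "z \<in> G" and less: "c * assoc_weight G (b L) z < assoc_weight G (A M m) z"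
  obtains P w where "\<And>N k. P \<in> Ha0_set G (A N k)" "w \<in> G" "c < A M m w * norm (P w)"
    "\<And>N z. N \<le> L \<Longrightarrow> z \<in> G \<Longrightarrow> A N (n N) z * norm (P z) \<le> 2"
proof -
  have b_ge: "A N (n N) x \<le> b L x" if "N \<le> L" for N x
    unfolding b_def using that by (intro Max_ge) auto
  have b_in: "\<exists>N\<le>L. b L x = A N (n N) x" for x
  proof -
    have "b L x \<in> (\<lambda>N. A N (n N) x) ` {..L}" unfolding b_def by (rule Max_in) auto
    then show ?thesis by auto
  qed
  have b_pos: "0 < b L x" if "x \<in> G" for x using A_pos[OF that] b_in[of x] by metis
  have b_rad: "radial G (b L)"
    using radial_A unfolding radial_def b_def by (simp cong: image_cong_simp)
  have "\<forall>N. \<exists>D. \<forall>x\<in>G. A N (n N) x \<le> D" using A_bounded by blast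
  then obtain D where D: "\<And>N x. x \<in> G \<Longrightarrow> A N (n N) x \<le> D N" by metis
  have D0: "D N \<ge> 0" for N
    using D[OF \<open>z \<in> G\<close>, of N] A_pos[OF \<open>z \<in> G\<close>, of N "n N"] by linarith
  have "b L x \<le> sum D {..L}" if "x \<in> G" for x
  proof -
    obtain N where N: "N \<le> L" "b L x = A N (n N) x" using b_in by blast
    have "D N \<le> sum D {..L}" using N(1) D0 by (intro member_le_sum) auto
    then show ?thesis using N(2) D[OF that, of N] by linarith
  qed
  then have gb: "0 < assoc_growth G (\<lambda>x. 1 / b L x) z"
    using assoc_growth_pos[OF \<open>z \<in> G\<close>, of "b L"] b_pos by blast
  have ga: "0 < assoc_growth G (\<lambda>x. 1 / A M m x) z" by (rule assoc_growth_A_pos[OF \<open>z \<in> G\<close>])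
  have "c * assoc_growth G (\<lambda>x. 1 / A M m x) z < assoc_growth G (\<lambda>x. 1 / b L x) z"
    using less ga gb unfolding assoc_weight_def by (simp add: field_simps)
  then obtain g where g: "g \<in> holo G" "\<And>x. x \<in> G \<Longrightarrow> norm (g x) \<le> 1 / b L x"
      "c * assoc_growth G (\<lambda>x. 1 / A M m x) z < norm (g z)"
    using b_pos by (elim less_assoc_growthE) (auto simp: less_imp_le)
  have "\<exists>w\<in>G. c < A M m w * norm (g w)"
  proof (rule ccontr)
    assume "\<not> ?thesis"
    then have le: "A M m x * norm (g x) \<le> c" if "x \<in> G" for x using that by force
    have "norm (of_real (1 / c) * g z) \<le> assoc_growth G (\<lambda>x. 1 / A M m x) z"
    proof (rule assoc_growth_upper[OF holo_cmult[OF g(1)] _ \<open>z \<in> G\<close>])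
      show "norm (of_real (1 / c) * g x) \<le> 1 / A M m x" if "x \<in> G" for x
        using le[OF that] A_pos[OF that] \<open>c > 0\<close> by (simp add: norm_mult norm_divide field_simps)
    qed
    then show False using g(3) \<open>c > 0\<close> by (simp add: norm_mult norm_divide field_simps)
  qed
  then obtain w where w: "w \<in> G" "c < A M m w * norm (g w)" by blast
  \<comment> \<open>Exactly the slack by which \<open>g\<close> exceeds c / A at \<open>w\<close>,
    so the approximating polynomial still exceeds it.\<close>
  define e where "e = norm (g w) - c / A M m w"
  have "e > 0" using w A_pos[OF w(1)] by (simp add: e_def divide_less_eq mult.commute)
  obtain P where P: "\<And>N n. P \<in> Ha0_set G (A N n)" "norm (P w - g w) < e"
    "\<forall>a C. radial G a \<longrightarrow> (\<forall>x\<in>G. 0 < a x) \<longrightarrow> (\<forall>x\<in>G. a x * norm (g x) \<le> C) \<longrightarrow>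
      (\<forall>z\<in>G. a z * norm (P z) \<le> 2 * C)"
    using weighted_polynomial_approximation[OF g(1) w(1) \<open>e > 0\<close>] by blast
  show ?thesis
  proof (rule that[OF P(1) w(1)])
    have "c / A M m w < norm (P w)"
      using P(2) norm_triangle_ineq3[of "P w" "g w"] unfolding e_def by linarith
    then show "c < A M m w * norm (P w)" using A_pos[OF w(1)] by (simp add: divide_less_eq mult.commute)
    fix N z assume "N \<le> L" and z: "z \<in> G"
    have "b L x * norm (g x) \<le> 1" if "x \<in> G" for x
      using g(2)[OF that] b_pos[OF that] by (simp add: le_divide_eq mult.commute)
    then have "b L z * norm (P z) \<le> 2 * 1"
      using P(3)[rule_format, OF b_rad b_pos _ z] by blast
    then show "A N (n N) z * norm (P z) \<le> 2"
      using mult_right_mono[OF b_ge[OF \<open>N \<le> L\<close>, of z] norm_ge_zero[of "P z"]] by simp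
  qed
qed

text \<open>A gliding hump replaces Grothendieck's factorization theorem: if (B) fails for \<open>n\<close>, then a
  series of polynomials converges in every step \<open>A N (n N)\<close> while the \<open>i\<close>-th partial sum is
  large at a point which the remaining terms hardly affect.\<close>

lemma gliding_hump:
  fixes n \<mu> :: "nat \<Rightarrow> nat"
  assumes hump: "\<And>m L c. c > 0 \<Longrightarrow> \<exists>P w. (\<forall>N k. P \<in> Ha0_set G (A N k)) \<and> w \<in> G \<and>
      c < A (\<mu> m) m w * norm (P w) \<and> (\<forall>N\<le>L. \<forall>z\<in>G. A N (n N) z * norm (P z) \<le> 2)"
  shows "\<exists>f. (\<forall>N. f \<in> Ha0_set G (A N (n N))) \<and> (\<forall>m. f \<notin> Ha_set G (A (\<mu> m) m))"
proof -
  \<comment> \<open>Decoding pairs visits each m infinitely often, hence at arbitrarily late stages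
    \<open>i\<close>.\<close>
  define a where "a i = (let m = fst (prod_decode i) in A (\<mu> m) m)" for i
  have a_pos: "0 < a i z" if "z \<in> G" for i z unfolding a_def Let_def by (rule A_pos[OF that])
  define I where "I i x \<longleftrightarrow> (\<forall>N k. fst x \<in> Ha0_set G (A N k)) \<and> 0 < fst (snd x)"
    for i :: nat and x :: "(complex^'d \<Rightarrow> complex) \<times> real \<times> (complex^'d)"
  \<comment> \<open>States are triples: partial sum, tolerance for all later changes, and point of
    the latest peak. Stage \<open>i\<close> controls only the steps N \<le> i, which is enough for
    convergence in each of them. The last clause keeps later changes small at the new peak.\<close>
  define Q where "Q i x y \<longleftrightarrow> snd (snd y) \<in> G \<and> 2 * fst (snd y) \<le> fst (snd x) \<and>
      (\<forall>N\<le>i. \<forall>z\<in>G. A N (n N) z * norm (fst y z - fst x z) \<le> fst (snd x)) \<and>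
      real i + 1 \<le> a i (snd (snd y)) * norm (fst y (snd (snd y))) \<and>
      2 * fst (snd y) * a i (snd (snd y)) \<le> A 0 (n 0) (snd (snd y))"
    for i and x y :: "(complex^'d \<Rightarrow> complex) \<times> real \<times> (complex^'d)"
  have "\<exists>h. \<forall>i. I i (h i) \<and> Q i (h i) (h (Suc i))"
  proof (rule dependent_nat_choice)
    show "\<exists>x. I 0 x"
      using polynomial_in_Ha0_set[OF complex_polynomial_const[of 0]]
      by (intro exI[of _ "(\<lambda>z. if z \<in> G then 0 else 0, 1, 0)"]) (simp add: I_def)
    fix x i assume "I i x"
    then obtain s \<delta> v where x: "x = (s, \<delta>, v)" and s: "\<And>N k. s \<in> Ha0_set G (A N k)" and "\<delta> > 0"
      unfolding I_def by (cases x) auto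
    define m where "m = fst (prod_decode i)"
    have ai: "a i = A (\<mu> m) m" by (simp add: a_def m_def Let_def)
    obtain D where "D > 0" and D: "\<And>z. z \<in> G \<Longrightarrow> a i z * norm (s z) \<le> D"
      using s Ha0_set_subset_Ha_set[OF wA] unfolding ai by (metis Ha_set_bound subsetD)
    \<comment> \<open>The hump is added with factor \<delta>/2, so at its peak it contributes more
      than D + i + 1; the old partial sum can cancel at most \<open>D\<close> of this.\<close>
    define c where "c = 2 * (D + real i + 1) / \<delta>"
    have "c > 0" unfolding c_def using \<open>D > 0\<close> \<open>\<delta> > 0\<close> by simp
    then obtain P w where P: "\<And>N k. P \<in> Ha0_set G (A N k)" and w: "w \<in> G" "c < a i w * norm (P w)"
      and P2: "\<And>N z. N \<le> i \<Longrightarrow> z \<in> G \<Longrightarrow> A N (n N) z * norm (P z) \<le> 2"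
      using hump[of c m i] unfolding ai by blast
    define s' where "s' z = s z + of_real (\<delta> / 2) * P z" for z
    \<comment> \<open>Halving makes the tolerances summable. The second entry converts a later
      change of at most 2 \<delta>', measured in \<open>A 0 (n 0)\<close>, into at most 1 in the
      weight \<open>a i\<close> at the peak.\<close>
    define \<delta>' where "\<delta>' = min (\<delta> / 2) (A 0 (n 0) w / (2 * a i w))"
    have "I (Suc i) (s', \<delta>', w)"
      unfolding I_def s'_def \<delta>'_def using s P \<open>\<delta> > 0\<close> A_pos[OF w(1)] a_pos[OF w(1)]
      by (auto intro!: Ha0_set_add Ha0_set_cmult wA simp del: of_real_divide)
    moreover have "Q i x (s', \<delta>', w)"
      unfolding Q_def x fst_conv snd_conv
    proof (intro conjI allI impI ballI)
      show "2 * \<delta>' \<le> \<delta>" by (simp add: \<delta>'_def)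
      show "A N (n N) z * norm (s' z - s z) \<le> \<delta>" if "N \<le> i" "z \<in> G" for N z
        using mult_left_mono[OF P2[OF that], of "\<delta> / 2"] \<open>\<delta> > 0\<close>
        by (simp add: s'_def norm_mult norm_divide algebra_simps)
      have "\<delta>' \<le> A 0 (n 0) w / (2 * a i w)" by (simp add: \<delta>'_def)
      then show "2 * \<delta>' * a i w \<le> A 0 (n 0) w"
        using a_pos[OF w(1), of i] by (simp add: le_divide_eq algebra_simps)
      have "D + (real i + 1) = \<delta> / 2 * c" unfolding c_def using \<open>\<delta> > 0\<close> by simp
      also have "\<dots> \<le> \<delta> / 2 * (a i w * norm (P w))" using w(2) \<open>\<delta> > 0\<close> by (intro mult_left_mono) auto
      also have "\<dots> = a i w * norm (s' w - s w)" using \<open>\<delta> > 0\<close> by (simp add: s'_def norm_mult norm_divide)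
      also have "\<dots> \<le> a i w * (norm (s' w) + norm (s w))"
        using a_pos[OF w(1), of i] by (intro mult_left_mono norm_triangle_ineq4) simp
      also have "\<dots> \<le> a i w * norm (s' w) + D" using D[OF w(1)] by (simp add: distrib_left)
      finally show "real i + 1 \<le> a i w * norm (s' w)" by simp
    qed (rule w(1))
    ultimately show "\<exists>y. I (Suc i) y \<and> Q i x y" by blast
  qed
  then obtain h where h: "\<And>i. I i (h i)" "\<And>i. Q i (h i) (h (Suc i))" by blast
  define s where "s i = fst (h i)" for i
  define \<delta> where "\<delta> i = fst (snd (h i))" for i
  define w where "w i = snd (snd (h (Suc i)))" for i
  have s: "s i \<in> Ha0_set G (A N k)" and \<delta>: "0 < \<delta> i" for i N k
    using h(1)[of i] unfolding I_def s_def \<delta>_def by auto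
  have w: "w i \<in> G" and \<delta>2: "2 * \<delta> (Suc i) \<le> \<delta> i"
    and big: "real i + 1 \<le> a i (w i) * norm (s (Suc i) (w i))"
    and small: "2 * \<delta> (Suc i) * a i (w i) \<le> A 0 (n 0) (w i)" for i
    using h(2)[of i] unfolding Q_def s_def \<delta>_def w_def by auto
  have step: "A N (n N) z * norm (s (Suc i) z - s i z) \<le> \<delta> i" if "N \<le> i" "z \<in> G" for N i z
    using h(2)[of i] that unfolding Q_def s_def \<delta>_def by auto
  have "\<delta> i \<le> \<delta> 0 * (1 / 2) ^ i" for i
  proof (induction i)
    case (Suc i) then show ?case using \<delta>2[of i] by simp
  qed simp
  moreover have "(\<lambda>i. \<delta> 0 * (1 / 2) ^ i) \<longlonglongrightarrow> 0"
    by (intro tendsto_mult_right_zero LIMSEQ_power_zero) simp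
  ultimately have \<delta>_lim: "\<delta> \<longlonglongrightarrow> 0"
    using \<delta> by (intro tendsto_sandwich[of "\<lambda>_. 0" \<delta> sequentially "\<lambda>i. \<delta> 0 * (1 / 2) ^ i"])
      (auto simp: less_imp_le)
  \<comment> \<open>The telescoping form survives the induction because halving gives
    \<open>\<delta> j \<le> 2 * \<delta> j - 2 * \<delta> (Suc j)\<close>.\<close>
  have "A N (n N) z * norm (s j z - s i z) \<le> 2 * \<delta> i - 2 * \<delta> j" if "N \<le> i" "i \<le> j" "z \<in> G" for N i j z
    using that(2)
  proof (induction j rule: dec_induct)
    case (step j)
    have "A N (n N) z * norm (s (Suc j) z - s i z) \<le>
        A N (n N) z * (norm (s (Suc j) z - s j z) + norm (s j z - s i z))"
      using A_pos[OF that(3), of N "n N"] norm_triangle_ineq[of "s (Suc j) z - s j z" "s j z - s i z"]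
      by (intro mult_left_mono) auto
    also have "\<dots> \<le> \<delta> j + (2 * \<delta> i - 2 * \<delta> j)"
      using step(3) \<open>\<And>N i z. N \<le> i \<Longrightarrow> z \<in> G \<Longrightarrow> A N (n N) z * norm (s (Suc i) z - s i z) \<le> \<delta> i\<close>[of N j z]
        step(1) that by (simp add: distrib_left)
    finally show ?case using \<delta>2[of j] by simp
  qed simp
  then have cau: "A N (n N) z * norm (s j z - s i z) \<le> 2 * \<delta> i" if "N \<le> i" "i \<le> j" "z \<in> G" for N i j z
    using that \<delta>[of j] by (smt (verit))
  define f where "f z = (if z \<in> G then lim (\<lambda>i. s i z) else 0)" for z
  have f: "(\<lambda>i. s i z) \<longlonglongrightarrow> f z" if z: "z \<in> G" for z
  proof -
    have "Cauchy (\<lambda>i. s i z)"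
    proof (rule metric_CauchyI, unfold dist_norm)
      fix e :: real assume "e > 0"
      then have "0 < A 0 (n 0) z * e / 2" using A_pos[OF z] by simp
      from eventually_happens'[OF sequentially_bot order_tendstoD(2)[OF \<delta>_lim this]]
      obtain i where "\<delta> i < A 0 (n 0) z * e / 2" by blast
      then have i: "2 * \<delta> i < A 0 (n 0) z * e" by simp
      have "norm (s i' z - s j z) < e" if "i' \<ge> i" "j \<ge> i'" for i' j
      proof -
        have "\<delta> i' \<le> \<delta> i" using \<open>i' \<ge> i\<close>
        proof (induction i' rule: dec_induct)
          case (step k) then show ?case using \<delta>2[of k] \<delta>[of "Suc k"] by simp
        qed simp
        then have "A 0 (n 0) z * norm (s j z - s i' z) < A 0 (n 0) z * e"
          using cau[of 0 i' j z] i that z by simp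
        then show ?thesis using A_pos[OF z, of 0 "n 0"] by (simp add: norm_minus_commute)
      qed
      then show "\<exists>M. \<forall>m\<ge>M. \<forall>n\<ge>M. norm (s m z - s n z) < e"
        by (metis linear norm_minus_commute)
    qed
    then have "convergent (\<lambda>i. s i z)" by (rule Cauchy_convergent)
    then have "(\<lambda>i. s i z) \<longlonglongrightarrow> lim (\<lambda>i. s i z)" by (simp only: convergent_LIMSEQ_iff)
    then show ?thesis using z by (simp only: f_def if_True)
  qed
  have tail: "A N (n N) z * norm (s i z - f z) \<le> 2 * \<delta> i" if "N \<le> i" "z \<in> G" for N i z
  proof (rule tendsto_upperbound)
    show "(\<lambda>j. A N (n N) z * norm (s i z - s j z)) \<longlonglongrightarrow> A N (n N) z * norm (s i z - f z)"
      by (intro tendsto_intros f that)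
    show "\<forall>\<^sub>F j in sequentially. A N (n N) z * norm (s i z - s j z) \<le> 2 * \<delta> i"
      using cau[OF that(1) _ that(2)] by (intro eventually_sequentiallyI[of i]) (simp add: norm_minus_commute)
  qed simp
  have f0: "f \<in> Ha0_set G (A N (n N))" for N
  proof (rule Ha0_set_limit[OF G(1) wA s])
    fix e :: real assume "e > 0"
    then have "\<forall>\<^sub>F i in sequentially. \<delta> i < e / 2"
      by (intro order_tendstoD(2)[OF \<delta>_lim]) simp
    then show "\<forall>\<^sub>F i in sequentially. \<forall>z\<in>G. A N (n N) z * norm (s i z - f z) \<le> e"
      using eventually_ge_at_top[of N]
    proof eventually_elim
      case (elim i)
      show ?case
      proof
        fix z assume "z \<in> G"
        from tail[OF elim(2) this] elim(1) show "A N (n N) z * norm (s i z - f z) \<le> e" by simp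
      qed
    qed
  qed (simp add: f_def)
  have "f \<notin> Ha_set G (A (\<mu> m) m)" for m
  proof
    assume "f \<in> Ha_set G (A (\<mu> m) m)"
    then obtain C where C: "\<And>z. z \<in> G \<Longrightarrow> A (\<mu> m) m z * norm (f z) \<le> C"
      using Ha_set_bound by blast
    obtain j :: nat where "C < real j" using reals_Archimedean2 by blast
    \<comment> \<open>A stage that treats \<open>m\<close> and is at least \<open>j\<close>, so its
      peak is higher than the supposed bound \<open>C\<close>.\<close>
    define i where "i = prod_encode (m, j)"
    have "j \<le> i" unfolding i_def by (rule le_prod_encode_2)
    have ai: "a i = A (\<mu> m) m" by (simp add: a_def i_def)
    \<comment> \<open>Step 0 is controlled from the first stage on, so its weight can measure the
      tail after every stage.\<close>
    have "A 0 (n 0) (w i) * norm (s (Suc i) (w i) - f (w i)) * a i (w i) \<le> 2 * \<delta> (Suc i) * a i (w i)"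
      using tail[of 0 "Suc i" "w i"] a_pos[OF w, of i i] w by (intro mult_right_mono) auto
    also have "\<dots> \<le> A 0 (n 0) (w i) * 1" using small[of i] by simp
    finally have 1: "a i (w i) * norm (s (Suc i) (w i) - f (w i)) \<le> 1"
      using A_pos[OF w, of 0 "n 0" i] by (simp add: ac_simps mult_le_cancel_left_pos)
    have "real i + 1 \<le> a i (w i) * (norm (f (w i)) + norm (s (Suc i) (w i) - f (w i)))"
      using big[of i] mult_left_mono[OF norm_triangle_sub[of "s (Suc i) (w i)" "f (w i)"], of "a i (w i)"]
        a_pos[OF w, of i i] by linarith
    also have "\<dots> \<le> C + 1" using 1 C[OF w[of i]] ai by (simp add: distrib_left)
    finally show False using \<open>C < real j\<close> \<open>j \<le> i\<close> by simp
  qed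
  with f0 show ?thesis by blast
qed

text \<open>Membership is assumed in the smaller spaces \<open>Ha0_set\<close> and concluded only in
  the larger \<open>Ha_set\<close>, so the criterion fits both equalities of limits.\<close>

lemma cond_B_if_factorizes:
  assumes fact: "\<And>n f. (\<And>N. f \<in> Ha0_set G (A N (n N))) \<Longrightarrow> \<exists>m. \<forall>M. f \<in> Ha_set G (A M m)"
  shows "cond_B G A"
  unfolding cond_B_def
proof (intro allI, rule ccontr)
  fix n :: "nat \<Rightarrow> nat"
  define V where "V M m = assoc_weight G (A M m)" for M m
  define W where "W L = assoc_weight G (\<lambda>x. Max ((\<lambda>N. A N (n N) x) ` {..L}))" for L
  assume "\<not> (\<exists>m. \<forall>M. \<exists>L. \<exists>c>0. \<forall>z\<in>G. assoc_weight G (A M m) z \<le>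
      c * assoc_weight G (\<lambda>x. Max ((\<lambda>N. A N (n N) x) ` {..L})) z)"
  then have "\<not> (\<exists>m. \<forall>M. \<exists>L. \<exists>c>0. \<forall>z\<in>G. V M m z \<le> c * W L z)"
    unfolding V_def W_def .
  \<comment> \<open>The M that refutes m is chosen before L and c, so \<open>\<mu>\<close> depends
    on m alone; the hump relies on this.\<close>
  then obtain \<mu> where \<mu>: "\<And>m L c. c > 0 \<Longrightarrow> \<exists>z\<in>G. c * W L z < V (\<mu> m) m z"
    by (metis not_le)
  have "\<exists>f. (\<forall>N. f \<in> Ha0_set G (A N (n N))) \<and> (\<forall>m. f \<notin> Ha_set G (A (\<mu> m) m))"
  proof (rule gliding_hump)
    fix m L and c :: real assume "c > 0"
    then obtain z where "z \<in> G" "c * W L z < V (\<mu> m) m z" using \<mu> by blast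
    then show "\<exists>P w. (\<forall>N k. P \<in> Ha0_set G (A N k)) \<and> w \<in> G \<and>
      c < A (\<mu> m) m w * norm (P w) \<and> (\<forall>N\<le>L. \<forall>z\<in>G. A N (n N) z * norm (P z) \<le> 2)"
      unfolding V_def W_def by (rule unbounded_polynomial[OF \<open>c > 0\<close>]) blast
  qed
  then show False using fact by blast
qed

end

section \<open>The topology of a seminorm\<close>

lemma fun_subspace_diff:
  assumes "fun_subspace E" "f \<in> E" "g \<in> E"
  shows "(\<lambda>x. f x - g x) \<in> E"
proof -
  have add: "\<And>f g. f \<in> E \<Longrightarrow> g \<in> E \<Longrightarrow> (\<lambda>x. f x + g x) \<in> E"
    and scale: "\<And>c f. f \<in> E \<Longrightarrow> (\<lambda>x. c * f x) \<in> E"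
    using assms(1) unfolding fun_subspace_def by auto
  from add[OF assms(2) scale[OF assms(3), of "-1"]] show ?thesis by simp
qed

text \<open>Openness is the ball criterion at each point, not generation by balls; this is a
  topology for every \<open>q\<close>, and a neighbourhood of any point can be read off
  directly.\<close>

definition seminorm_topology ::
    "('x \<Rightarrow> complex) set \<Rightarrow> (('x \<Rightarrow> complex) \<Rightarrow> real) \<Rightarrow> ('x \<Rightarrow> complex) topology" where
  "seminorm_topology E q = topology (\<lambda>U. U \<subseteq> E \<and>
     (\<forall>f\<in>U. \<exists>r>0. \<forall>g\<in>E. q (\<lambda>x. g x - f x) < r \<longrightarrow> g \<in> U))"

lemma openin_seminorm_topology:
  "openin (seminorm_topology E q) U \<longleftrightarrow> U \<subseteq> E \<and>
     (\<forall>f\<in>U. \<exists>r>0. \<forall>g\<in>E. q (\<lambda>x. g x - f x) < r \<longrightarrow> g \<in> U)"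
proof -
  let ?P = "\<lambda>U. U \<subseteq> E \<and> (\<forall>f\<in>U. \<exists>r>0. \<forall>g\<in>E. q (\<lambda>x. g x - f x) < r \<longrightarrow> g \<in> U)"
  have "istopology ?P"
    unfolding istopology_def
  proof (intro conjI allI impI)
    fix S T assume ST: "?P S" "?P T"
    show "S \<inter> T \<subseteq> E" using ST by blast
    show "\<forall>f\<in>S \<inter> T. \<exists>r>0. \<forall>g\<in>E. q (\<lambda>x. g x - f x) < r \<longrightarrow> g \<in> S \<inter> T"
    proof
      fix f assume "f \<in> S \<inter> T"
      then obtain r s where "r > 0" "\<And>g. g \<in> E \<Longrightarrow> q (\<lambda>x. g x - f x) < r \<Longrightarrow> g \<in> S"
        "s > 0" "\<And>g. g \<in> E \<Longrightarrow> q (\<lambda>x. g x - f x) < s \<Longrightarrow> g \<in> T"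
        using ST by (metis IntD1 IntD2)
      then show "\<exists>r>0. \<forall>g\<in>E. q (\<lambda>x. g x - f x) < r \<longrightarrow> g \<in> S \<inter> T"
        by (intro exI[of _ "min r s"]) simp
    qed
  next
    fix K assume K: "\<forall>S\<in>K. ?P S"
    then show "\<Union> K \<subseteq> E" by blast
    show "\<forall>f\<in>\<Union> K. \<exists>r>0. \<forall>g\<in>E. q (\<lambda>x. g x - f x) < r \<longrightarrow> g \<in> \<Union> K"
    proof
      fix f assume "f \<in> \<Union> K"
      then obtain S where "S \<in> K" "f \<in> S" by blast
      with K obtain r where "r > 0" "\<forall>g\<in>E. q (\<lambda>x. g x - f x) < r \<longrightarrow> g \<in> S" by meson
      with \<open>S \<in> K\<close> show "\<exists>r>0. \<forall>g\<in>E. q (\<lambda>x. g x - f x) < r \<longrightarrow> g \<in> \<Union> K" by (meson UnionI)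
    qed
  qed
  then show ?thesis unfolding seminorm_topology_def by (simp add: topology_inverse')
qed

lemma topspace_seminorm_topology: "topspace (seminorm_topology E q) = E"
proof
  show "topspace (seminorm_topology E q) \<subseteq> E"
    using openin_topspace openin_seminorm_topology by blast
  have "openin (seminorm_topology E q) E"
    unfolding openin_seminorm_topology using zero_less_one by blast
  then show "E \<subseteq> topspace (seminorm_topology E q)" by (rule openin_subset)
qed

context
  fixes E :: "('x \<Rightarrow> complex) set" and q :: "('x \<Rightarrow> complex) \<Rightarrow> real"
  assumes E: "fun_subspace E"
    and q_add: "\<And>f g. f \<in> E \<Longrightarrow> g \<in> E \<Longrightarrow> q (\<lambda>x. f x + g x) \<le> q f + q g"
    and q_scale: "\<And>c f. f \<in> E \<Longrightarrow> q (\<lambda>x. c * f x) \<le> norm c * q f"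
    and q_nonneg: "\<And>f. f \<in> E \<Longrightarrow> 0 \<le> q f"
begin

private lemma E_add: "f \<in> E \<Longrightarrow> g \<in> E \<Longrightarrow> (\<lambda>x. f x + g x) \<in> E"
  and E_scale: "f \<in> E \<Longrightarrow> (\<lambda>x. c * f x) \<in> E"
  and E_zero: "(\<lambda>x. 0) \<in> E"
  using E unfolding fun_subspace_def by auto

private lemma E_diff: "f \<in> E \<Longrightarrow> g \<in> E \<Longrightarrow> (\<lambda>x. f x - g x) \<in> E"
  using fun_subspace_diff[OF E] .

private lemma q_zero: "q (\<lambda>x. 0) = 0"
  using q_scale[OF E_zero, of 0] q_nonneg[OF E_zero] by simp

private lemma q_diff_triangle:
  assumes "f \<in> E" "g \<in> E" "h \<in> E"
  shows "q (\<lambda>x. f x - h x) \<le> q (\<lambda>x. f x - g x) + q (\<lambda>x. g x - h x)"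
  using q_add[OF E_diff[OF assms(1,2)] E_diff[OF assms(2,3)]] by simp

lemma openin_seminorm_ball:
  assumes "f \<in> E"
  shows "openin (seminorm_topology E q) {g \<in> E. q (\<lambda>x. g x - f x) < r}"
  unfolding openin_seminorm_topology
proof (intro conjI ballI)
  fix g assume g: "g \<in> {g \<in> E. q (\<lambda>x. g x - f x) < r}"
  have "q (\<lambda>x. h x - f x) < r" if "h \<in> E" "q (\<lambda>x. h x - g x) < r - q (\<lambda>x. g x - f x)" for h
    using q_diff_triangle[of h g f] that assms g by simp
  then show "\<exists>s>0. \<forall>h\<in>E. q (\<lambda>x. h x - g x) < s \<longrightarrow> h \<in> {g \<in> E. q (\<lambda>x. g x - f x) < r}"
    using g by (intro exI[of _ "r - q (\<lambda>x. g x - f x)"]) simp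
qed blast

text \<open>This admits the topology of a seminorm as a competitor in the definition of
  \<open>lc_ind\<close>, whence continuity of a seminorm on an inductive limit can be tested on the
  steps.\<close>

lemma lc_topology_seminorm_topology: "lc_topology (seminorm_topology E q)"
  unfolding lc_topology_def
proof (intro conjI allI impI)
  let ?T = "seminorm_topology E q"
  show "fun_subspace (topspace ?T)" using E by (simp add: topspace_seminorm_topology)
  show "continuous_map (prod_topology ?T ?T) ?T (\<lambda>(f, g). \<lambda>x. f x + g x)"
    unfolding continuous_map_def
  proof (intro conjI allI impI)
    show "(\<lambda>(f, g). \<lambda>x. f x + g x) \<in> topspace (prod_topology ?T ?T) \<rightarrow> topspace ?T"
      by (auto simp: topspace_seminorm_topology E_add)
    fix U assume U: "openin ?T U"
    let ?S = "{p \<in> topspace (prod_topology ?T ?T). (case p of (f, g) \<Rightarrow> \<lambda>x. f x + g x) \<in> U}"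
    show "openin (prod_topology ?T ?T) ?S"
      unfolding openin_prod_topology_alt
    proof (intro allI impI)
      fix f g assume "(f, g) \<in> ?S"
      then have f: "f \<in> E" and g: "g \<in> E" and fg: "(\<lambda>x. f x + g x) \<in> U"
        by (auto simp: topspace_seminorm_topology)
      obtain r where r: "r > 0" "\<And>h. h \<in> E \<Longrightarrow> q (\<lambda>x. h x - (f x + g x)) < r \<Longrightarrow> h \<in> U"
        using U fg unfolding openin_seminorm_topology by meson
      let ?B = "\<lambda>f. {g \<in> E. q (\<lambda>x. g x - f x) < r / 2}"
      have "(\<lambda>x. f' x + g' x) \<in> U" if "f' \<in> ?B f" "g' \<in> ?B g" for f' g'
      proof (rule r(2))
        show "(\<lambda>x. f' x + g' x) \<in> E" using that E_add by blast
        have "q (\<lambda>x. (f' x - f x) + (g' x - g x)) \<le> q (\<lambda>x. f' x - f x) + q (\<lambda>x. g' x - g x)"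
          using that f g by (intro q_add E_diff) auto
        then show "q (\<lambda>x. f' x + g' x - (f x + g x)) < r" using that by (simp add: algebra_simps)
      qed
      then have "?B f \<times> ?B g \<subseteq> ?S" by (auto simp: topspace_seminorm_topology)
      moreover have "f \<in> ?B f" "g \<in> ?B g" using f g r(1) by (simp_all add: q_zero)
      ultimately show "\<exists>U V. openin ?T U \<and> openin ?T V \<and> f \<in> U \<and> g \<in> V \<and> U \<times> V \<subseteq> ?S"
        using openin_seminorm_ball f g by blast
    qed
  qed
  show "continuous_map (prod_topology euclidean ?T) ?T (\<lambda>(c, f). \<lambda>x. c * f x)"
    unfolding continuous_map_def
  proof (intro conjI allI impI)
    show "(\<lambda>(c, f). \<lambda>x. c * f x) \<in> topspace (prod_topology euclidean ?T) \<rightarrow> topspace ?T"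
      by (auto simp: topspace_seminorm_topology E_scale)
    fix U assume U: "openin ?T U"
    let ?S = "{p \<in> topspace (prod_topology euclidean ?T). (case p of (c, f) \<Rightarrow> \<lambda>x. c * f x) \<in> U}"
    show "openin (prod_topology euclidean ?T) ?S"
      unfolding openin_prod_topology_alt
    proof (intro allI impI)
      fix c f assume "(c, f) \<in> ?S"
      then have f: "f \<in> E" and cf: "(\<lambda>x. c * f x) \<in> U" by (auto simp: topspace_seminorm_topology)
      obtain r where r: "r > 0" "\<And>h. h \<in> E \<Longrightarrow> q (\<lambda>x. h x - c * f x) < r \<Longrightarrow> h \<in> U"
        using U cf unfolding openin_seminorm_topology by meson
      \<comment> \<open>The radii fit the splitting c' f' - c f = c' (f' - f) + (c' - c) f, each
        summand getting r/2. The bound 1 on \<open>d\<close> keeps |c'| at most |c| + 1, and adding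
        1 avoids zero denominators.\<close>
      define d where "d = min 1 (r / 2 / (q f + 1))"
      define e where "e = r / 2 / (norm c + 1)"
      have qf: "0 < q f + 1" using q_nonneg[OF f] by simp
      have nc: "0 < norm c + 1" using norm_ge_zero[of c] by linarith
      have "d > 0" "e > 0" unfolding d_def e_def using r(1) qf nc by auto
      let ?B = "{g \<in> E. q (\<lambda>x. g x - f x) < e}"
      have "(\<lambda>x. c' * f' x) \<in> U" if c': "c' \<in> ball c d" and f': "f' \<in> ?B" for c' f'
      proof (rule r(2))
        show "(\<lambda>x. c' * f' x) \<in> E" using f' E_scale by blast
        have "q (\<lambda>x. c' * (f' x - f x) + (c' - c) * f x) \<le>
            q (\<lambda>x. c' * (f' x - f x)) + q (\<lambda>x. (c' - c) * f x)"
          using f f' by (intro q_add E_scale E_diff) auto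
        also have "\<dots> \<le> norm c' * q (\<lambda>x. f' x - f x) + norm (c' - c) * q f"
          using f f' by (intro add_mono q_scale E_diff) auto
        also have "\<dots> < r / 2 + r / 2"
        proof (rule add_less_le_mono)
          have "norm c' \<le> norm c + 1"
            using c' norm_triangle_sub[of c' c] unfolding d_def by (simp add: dist_norm norm_minus_commute)
          then have "norm c' * q (\<lambda>x. f' x - f x) \<le> (norm c + 1) * q (\<lambda>x. f' x - f x)"
            using f f' by (intro mult_right_mono q_nonneg E_diff) auto
          also have "\<dots> < (norm c + 1) * e" using f' nc by (intro mult_strict_left_mono) auto
          also have "\<dots> = r / 2" using nc nonzero_eq_divide_eq e_def by (metis less_irrefl mult.commute)
          finally show "norm c' * q (\<lambda>x. f' x - f x) < r / 2" .
          have "norm (c' - c) * q f \<le> d * (q f + 1)"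
            using c' q_nonneg[OF f] \<open>d > 0\<close> by (intro mult_mono) (auto simp: dist_norm norm_minus_commute)
          also have "\<dots> \<le> r / 2 / (q f + 1) * (q f + 1)"
            using qf by (intro mult_right_mono) (auto simp: d_def)
          also have "\<dots> = r / 2" using qf nonzero_eq_divide_eq by (metis less_irrefl)
          finally show "norm (c' - c) * q f \<le> r / 2" .
        qed
        finally show "q (\<lambda>x. c' * f' x - c * f x) < r" by (simp add: algebra_simps)
      qed
      then have "ball c d \<times> ?B \<subseteq> ?S" by (auto simp: topspace_seminorm_topology)
      moreover have "f \<in> ?B" "c \<in> ball c d" using f \<open>e > 0\<close> \<open>d > 0\<close> by (simp_all add: q_zero)
      moreover have "openin euclidean (ball c d)" by simp
      ultimately show "\<exists>U V. openin euclidean U \<and> openin ?T V \<and> c \<in> U \<and> f \<in> V \<and> U \<times> V \<subseteq> ?S"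
        using openin_seminorm_ball[OF f] by blast
    qed
  qed
  show "\<exists>V W. fun_convex V \<and> openin ?T W \<and> (\<lambda>x. 0) \<in> W \<and> W \<subseteq> V \<and> V \<subseteq> U"
    if U: "openin ?T U \<and> (\<lambda>x. 0) \<in> U" for U
  proof -
    obtain r where r: "r > 0" "\<And>h. h \<in> E \<Longrightarrow> q (\<lambda>x. h x - 0) < r \<Longrightarrow> h \<in> U"
      using U unfolding openin_seminorm_topology by meson
    let ?B = "{g \<in> E. q (\<lambda>x. g x - 0) < r}"
    have "fun_convex ?B"
      unfolding fun_convex_def
    proof (intro ballI)
      fix f g and t :: real assume f: "f \<in> ?B" and g: "g \<in> ?B" and t: "t \<in> {0..1}"
      have "q (\<lambda>x. of_real (1 - t) * f x + of_real t * g x) \<le>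
          q (\<lambda>x. of_real (1 - t) * f x) + q (\<lambda>x. of_real t * g x)"
        using f g by (intro q_add E_scale) auto
      also have "\<dots> \<le> norm (of_real (1 - t) :: complex) * q f + norm (of_real t :: complex) * q g"
        using f g by (intro add_mono q_scale) auto
      also have "\<dots> = (1 - t) * q f + t * q g" using t by (simp only: norm_of_real) simp
      also have "\<dots> < r"
        using convex_bound_lt[of "q f" r "q g" "1 - t" t] f g t by simp
      finally show "(\<lambda>x. of_real (1 - t) * f x + of_real t * g x) \<in> ?B"
        using f g E_add E_scale by simp
    qed
    moreover have "(\<lambda>x. 0) \<in> ?B" using E_zero r(1) by (simp add: q_zero)
    ultimately show ?thesis using openin_seminorm_ball[OF E_zero, of r] r(2) by blast
  qed
qed

end

section \<open>Neighbourhoods of zero in the weighted spaces\<close>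

lemma Ha_set_add: "f \<in> Ha_set G a \<Longrightarrow> g \<in> Ha_set G a \<Longrightarrow> weight G a \<Longrightarrow> (\<lambda>z. f z + g z) \<in> Ha_set G a"
proof -
  assume f: "f \<in> Ha_set G a" and g: "g \<in> Ha_set G a" and a: "weight G a"
  obtain C where C: "\<forall>z\<in>G. a z * norm (f z) \<le> C" using Ha_set_bound[OF f] by blast
  obtain D where D: "\<forall>z\<in>G. a z * norm (g z) \<le> D" using Ha_set_bound[OF g] by blast
  have "a z * norm (f z + g z) \<le> C + D" if z: "z \<in> G" for z
  proof -
    have "a z * norm (f z + g z) \<le> a z * (norm (f z) + norm (g z))"
      using weight_pos[OF a z] by (intro mult_left_mono norm_triangle_ineq) simp
    then show ?thesis using bspec[OF C z] bspec[OF D z] by (simp add: distrib_left)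
  qed
  then show ?thesis using f g holo_add unfolding Ha_set_def by (auto intro!: bdd_aboveI2)
qed

lemma Ha_set_cmult: assumes f: "f \<in> Ha_set G a" shows "(\<lambda>z. c * f z) \<in> Ha_set G a"
proof -
  obtain C where C: "\<forall>z\<in>G. a z * norm (f z) \<le> C" using Ha_set_bound[OF f] by blast
  have "a z * norm (c * f z) \<le> norm c * C" if "z \<in> G" for z
    using mult_left_mono[OF bspec[OF C that] norm_ge_zero[of c]] by (simp add: norm_mult mult.left_commute)
  then show ?thesis using f holo_cmult unfolding Ha_set_def by (auto intro!: bdd_aboveI2)
qed

lemma fun_subspace_Ha_set: "weight G a \<Longrightarrow> fun_subspace (Ha_set G a)"
proof -
  assume a: "weight G a"
  have "(\<lambda>z. 0) \<in> Ha_set G a" by (auto simp: Ha_set_def zero_holo)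
  then show ?thesis
    unfolding fun_subspace_def using Ha_set_add[OF _ _ a] Ha_set_cmult by blast
qed

lemma fun_subspace_Ha0_set: "weight G a \<Longrightarrow> fun_subspace (Ha0_set G a)"
proof -
  assume a: "weight G a"
  have "(\<lambda>z. 0) \<in> Ha0_set G a"
    by (auto simp: Ha0_set_def zero_holo vanishes_at_inf_on_def)
  then show ?thesis
    unfolding fun_subspace_def using Ha0_set_add[OF a] Ha0_set_cmult by blast
qed

lemma wnorm_upper: "f \<in> Ha_set G a \<Longrightarrow> z \<in> G \<Longrightarrow> a z * norm (f z) \<le> wnorm G a f"
  unfolding wnorm_def Ha_set_def by (auto intro: cSUP_upper)

lemma wnorm_least: "G \<noteq> {} \<Longrightarrow> (\<And>z. z \<in> G \<Longrightarrow> a z * norm (f z) \<le> C) \<Longrightarrow> wnorm G a f \<le> C"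
  unfolding wnorm_def by (intro cSUP_least)

lemma wnorm_nonneg: "f \<in> Ha_set G a \<Longrightarrow> weight G a \<Longrightarrow> G \<noteq> {} \<Longrightarrow> 0 \<le> wnorm G a f"
proof -
  assume f: "f \<in> Ha_set G a" "weight G a" and "G \<noteq> {}"
  then obtain z where z: "z \<in> G" by blast
  have "0 \<le> a z * norm (f z)" using weight_pos[OF f(2) z] by simp
  also have "\<dots> \<le> wnorm G a f" by (rule wnorm_upper[OF f(1) z])
  finally show ?thesis .
qed

lemma topspace_Ha:
  assumes "G \<noteq> {}" shows "topspace (Ha G a) = Ha_set G a"
proof -
  have "wnorm G a (\<lambda>z. f z - f z) < 1" for f
    using wnorm_least[OF assms, of a "\<lambda>z. f z - f z" 0] by simp
  then have "f \<in> {g \<in> Ha_set G a. wnorm G a (\<lambda>z. g z - f z) < 1}" if "f \<in> Ha_set G a" for f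
    using that by blast
  then show ?thesis unfolding Ha_def topology_generated_by_topspace by blast
qed

lemma openin_Ha_ball: "f \<in> Ha_set G a \<Longrightarrow> openin (Ha G a) {g \<in> Ha_set G a. wnorm G a (\<lambda>z. g z - f z) < r}"
  unfolding Ha_def by (intro topology_generated_by_Basis) blast

text \<open>A generating ball may have any centre \<open>f\<close>; if it contains zero, the
  triangle inequality puts a ball about zero inside it.\<close>

lemma Ha_zero_nbhd:
  assumes a: "weight G a" and "G \<noteq> {}" and U: "openin (Ha G a) U" "(\<lambda>z. 0) \<in> U"
  shows "\<exists>e>0. \<forall>g\<in>Ha_set G a. wnorm G a g < e \<longrightarrow> g \<in> U"
proof -
  have "generate_topology_on {{g \<in> Ha_set G a. wnorm G a (\<lambda>z. g z - f z) < r} |f r. f \<in> Ha_set G a} U"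
    using U(1) unfolding Ha_def openin_topology_generated_by_iff .
  then show ?thesis using U(2)
  proof induction
    case (Int V W)
    from Int.IH(1) Int.prems obtain d where d: "d > 0" "\<forall>g\<in>Ha_set G a. wnorm G a g < d \<longrightarrow> g \<in> V"
      by auto
    from Int.IH(2) Int.prems obtain e where e: "e > 0" "\<forall>g\<in>Ha_set G a. wnorm G a g < e \<longrightarrow> g \<in> W"
      by auto
    show ?case using d e by (intro exI[of _ "min d e"]) simp
  next
    case (UN K)
    then obtain V where "V \<in> K" "(\<lambda>z. 0) \<in> V" by blast
    with UN.IH[OF this] show ?case by (meson UnionI)
  next
    case (Basis V)
    then obtain f r where f: "f \<in> Ha_set G a" and V: "V = {g \<in> Ha_set G a. wnorm G a (\<lambda>z. g z - f z) < r}"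
      by blast
    let ?f = "\<lambda>z. 0 - f z"
    have mf: "?f \<in> Ha_set G a" using Ha_set_cmult[OF f, of "-1"] by simp
    have "wnorm G a (\<lambda>z. g z - f z) \<le> wnorm G a g + wnorm G a ?f" if g: "g \<in> Ha_set G a" for g
    proof (rule wnorm_least[OF \<open>G \<noteq> {}\<close>])
      fix z assume z: "z \<in> G"
      have "a z * norm (g z - f z) \<le> a z * (norm (g z) + norm (?f z))"
        using weight_pos[OF a z] norm_triangle_ineq4[of "g z" "f z"] by (intro mult_left_mono) auto
      then show "a z * norm (g z - f z) \<le> wnorm G a g + wnorm G a ?f"
        using wnorm_upper[OF g z] wnorm_upper[OF mf z] by (simp add: distrib_left)
    qed
    moreover have "wnorm G a ?f < r" using Basis V by simp
    ultimately have "\<forall>g\<in>Ha_set G a. wnorm G a g < r - wnorm G a ?f \<longrightarrow> g \<in> V" "r - wnorm G a ?f > 0"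
      unfolding V by fastforce+
    then show ?case by blast
  qed simp
qed

section \<open>The projective and inductive limits\<close>

lemma wnorm_mono:
  assumes "G \<noteq> {}" "f \<in> Ha_set G b" "\<And>z. z \<in> G \<Longrightarrow> a z \<le> b z"
  shows "wnorm G a f \<le> wnorm G b f"
proof (rule wnorm_least[OF assms(1)])
  fix z assume z: "z \<in> G"
  have "a z * norm (f z) \<le> b z * norm (f z)" using assms(3)[OF z] by (intro mult_right_mono) auto
  then show "a z * norm (f z) \<le> wnorm G b f" using wnorm_upper[OF assms(2) z] by linarith
qed

lemma Ha_set_mono:
  assumes "\<And>z. z \<in> G \<Longrightarrow> a z \<le> b z"
  shows "Ha_set G b \<subseteq> Ha_set G a"
proof
  fix f assume f: "f \<in> Ha_set G b"
  then obtain C where C: "\<forall>z\<in>G. b z * norm (f z) \<le> C" using Ha_set_bound by blast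
  have "a z * norm (f z) \<le> C" if "z \<in> G" for z
    using mult_right_mono[OF assms[OF that] norm_ge_zero[of "f z"]] bspec[OF C that] by linarith
  then show "f \<in> Ha_set G a" using f unfolding Ha_set_def by (auto intro!: bdd_aboveI2)
qed

lemma Ha0_set_mono:
  assumes a: "weight G a" and le: "\<And>z. z \<in> G \<Longrightarrow> a z \<le> b z"
  shows "Ha0_set G b \<subseteq> Ha0_set G a"
proof
  fix f assume f: "f \<in> Ha0_set G b"
  have "vanishes_at_inf_on G (\<lambda>z. a z * norm (f z))"
    unfolding vanishes_at_inf_on_def
  proof (intro allI impI)
    fix e :: real assume e: "e > 0"
    have "vanishes_at_inf_on G (\<lambda>z. b z * norm (f z))" using f by (simp add: Ha0_set_def)
    from this[unfolded vanishes_at_inf_on_def, rule_format, OF e]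
    obtain K where K: "compact K" "K \<subseteq> G" "\<And>z. z \<in> G - K \<Longrightarrow> \<bar>b z * norm (f z)\<bar> < e" by blast
    have "\<bar>a z * norm (f z)\<bar> < e" if z: "z \<in> G - K" for z
    proof -
      have "0 < a z" "a z \<le> b z" using z le weight_pos[OF a] by blast+
      then have "\<bar>a z * norm (f z)\<bar> \<le> \<bar>b z * norm (f z)\<bar>" by (simp add: abs_mult mult_right_mono)
      then show ?thesis using K(3)[OF z] by linarith
    qed
    then show "\<exists>K. compact K \<and> K \<subseteq> G \<and> (\<forall>z\<in>G - K. \<bar>a z * norm (f z)\<bar> < e)" using K by blast
  qed
  then show "f \<in> Ha0_set G a" using f by (simp add: Ha0_set_def)
qed

text \<open>The two parts of the theorem are the instances \<open>Z a = UNIV\<close> and \<open>Z a = Ha0_set G a\<close>.\<close>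

locale weighted_spaces = balanced_weights G A
  for G :: "(complex^'d) set" and A :: "nat \<Rightarrow> nat \<Rightarrow> complex^'d \<Rightarrow> real" +
  fixes Z :: "(complex^'d \<Rightarrow> real) \<Rightarrow> (complex^'d \<Rightarrow> complex) set"
  assumes Z: "Z = (\<lambda>a. UNIV) \<or> Z = Ha0_set G"
begin

definition "H N n = subtopology (Ha G (A N n)) (Z (A N n))"
definition "X N n = Ha_set G (A N n) \<inter> Z (A N n)"
definition "AHZ = lc_proj (\<lambda>N. lc_ind (\<lambda>n. H N n))"
definition "VHZ = lc_ind (\<lambda>n. lc_proj (\<lambda>N. H N n))"

lemma X_subset: "X N n \<subseteq> Ha_set G (A N n)"
  unfolding X_def by blast

lemma Ha0_set_subset_X: "Ha0_set G (A N n) \<subseteq> X N n"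
  using Z Ha0_set_subset_Ha_set[OF wA[of N n]] unfolding X_def by auto

lemma X_subspace: "fun_subspace (X N n)"
  using Z
proof
  assume "Z = (\<lambda>a. UNIV)"
  then have "X N n = Ha_set G (A N n)" unfolding X_def by simp
  then show ?thesis using fun_subspace_Ha_set[OF wA[of N n]] by simp
next
  assume "Z = Ha0_set G"
  then have "X N n = Ha0_set G (A N n)"
    using Ha0_set_subset_Ha_set[OF wA[of N n]] unfolding X_def by auto
  then show ?thesis using fun_subspace_Ha0_set[OF wA[of N n]] by simp
qed

lemma X_mono:
  assumes "M \<le> N" "n \<le> m" shows "X N n \<subseteq> X M m"
proof -
  have le: "A M m z \<le> A N n z" if "z \<in> G" for z
    using A_mono_left[OF assms(1) that] A_antimono_right[OF assms(2) that] order_trans by blast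
  have "Z (A N n) \<subseteq> Z (A M m)"
    using Z
  proof
    assume "Z = Ha0_set G"
    then show ?thesis using Ha0_set_mono[OF wA, of M m "A N n"] le by simp
  qed simp
  then show ?thesis using Ha_set_mono[of G "A M m" "A N n"] le unfolding X_def by blast
qed

lemma wnorm_X_mono:
  assumes "M \<le> N" "f \<in> X N n" shows "wnorm G (A M n) f \<le> wnorm G (A N n) f"
  using assms X_subset A_mono_left by (intro wnorm_mono[OF G(2)]) auto

lemma topspace_H: "topspace (H N n) = X N n"
  unfolding H_def X_def topspace_subtopology topspace_Ha[OF G(2)] ..

lemma H_zero_nbhd:
  assumes "openin (H N n) U" "(\<lambda>z. 0) \<in> U"
  shows "\<exists>e>0. \<forall>g\<in>X N n. wnorm G (A N n) g < e \<longrightarrow> g \<in> U"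
proof -
  obtain T where T: "openin (Ha G (A N n)) T" "U = T \<inter> Z (A N n)"
    using assms(1) unfolding H_def openin_subtopology by blast
  then have "(\<lambda>z. 0) \<in> T" using assms(2) by blast
  from Ha_zero_nbhd[OF wA G(2) T(1) this] show ?thesis unfolding T(2) X_def by blast
qed

lemma openin_H_ball:
  assumes "f \<in> X N n"
  shows "openin (H N n) {g \<in> X N n. wnorm G (A N n) (\<lambda>z. g z - f z) < r}"
proof -
  have "{g \<in> X N n. wnorm G (A N n) (\<lambda>z. g z - f z) < r} =
      {g \<in> Ha_set G (A N n). wnorm G (A N n) (\<lambda>z. g z - f z) < r} \<inter> Z (A N n)"
    unfolding X_def by blast
  then show ?thesis
    unfolding H_def openin_subtopology using openin_Ha_ball[of f G "A N n" r] assms X_subset by blast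
qed

lemma UN_X_subspace: "fun_subspace (\<Union>n. topspace (H N n))"
  unfolding topspace_H by (intro fun_subspace_UN_incseq X_subspace incseq_SucI X_mono) auto

lemma topspace_AHZ: "topspace AHZ = (\<Inter>N. \<Union>n. X N n)"
  unfolding AHZ_def topspace_lc_proj topspace_lc_ind[OF UN_X_subspace] topspace_H ..

lemma INT_X_subspace: "fun_subspace (\<Inter>N. X N n)"
  by (intro fun_subspace_INT X_subspace)

lemma UN_INT_X_subspace: "fun_subspace (\<Union>n. topspace (lc_proj (\<lambda>N. H N n)))"
  unfolding topspace_lc_proj topspace_H
proof (intro fun_subspace_UN_incseq INT_X_subspace incseq_SucI)
  show "(\<Inter>N. X N n) \<subseteq> (\<Inter>N. X N (Suc n))" for n using X_mono[of _ _ n "Suc n"] by fastforce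
qed

lemma topspace_VHZ: "topspace VHZ = (\<Union>n. \<Inter>N. X N n)"
  unfolding VHZ_def topspace_lc_ind[OF UN_INT_X_subspace] topspace_lc_proj topspace_H ..

text \<open>Finitely many projective steps are dominated by the largest, since the norms increase
  with the step; so one \<open>M\<close> controls the neighbourhood. Inside that inductive limit,
  continuity of each inclusion provides a radius depending on \<open>m\<close>.\<close>

lemma AHZ_zero_nbhd:
  assumes "openin AHZ W" "(\<lambda>z. 0) \<in> W"
  shows "\<exists>M. \<forall>m. \<exists>e>0. \<forall>f\<in>topspace AHZ. f \<in> X M m \<longrightarrow> wnorm G (A M m) f < e \<longrightarrow> f \<in> W"
proof -
  let ?E = "\<lambda>N. lc_ind (\<lambda>n. H N n)"
  have "generate_topology_on {U \<inter> (\<Inter>N. topspace (?E N)) |U N. openin (?E N) U} W"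
    using assms(1) unfolding AHZ_def lc_proj_def openin_topology_generated_by_iff .
  then show ?thesis using assms(2)
  proof induction
    case (Int V W)
    from Int.IH(1) Int.prems obtain M where
      M: "\<forall>m. \<exists>e>0. \<forall>f\<in>topspace AHZ. f \<in> X M m \<longrightarrow> wnorm G (A M m) f < e \<longrightarrow> f \<in> V" by auto
    from Int.IH(2) Int.prems obtain N where
      N: "\<forall>m. \<exists>e>0. \<forall>f\<in>topspace AHZ. f \<in> X N m \<longrightarrow> wnorm G (A N m) f < e \<longrightarrow> f \<in> W" by auto
    let ?L = "max M N"
    have "\<exists>e>0. \<forall>f\<in>topspace AHZ. f \<in> X ?L m \<longrightarrow> wnorm G (A ?L m) f < e \<longrightarrow> f \<in> V \<inter> W" for m
    proof -
      obtain d where d: "d > 0" "\<forall>f\<in>topspace AHZ. f \<in> X M m \<longrightarrow> wnorm G (A M m) f < d \<longrightarrow> f \<in> V"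
        using M by blast
      obtain e where e: "e > 0" "\<forall>f\<in>topspace AHZ. f \<in> X N m \<longrightarrow> wnorm G (A N m) f < e \<longrightarrow> f \<in> W"
        using N by blast
      show ?thesis
      proof (intro exI[of _ "min d e"] conjI ballI impI)
        show "0 < min d e" using d e by simp
        fix f assume f: "f \<in> topspace AHZ" "f \<in> X ?L m" "wnorm G (A ?L m) f < min d e"
        have "f \<in> X M m" "f \<in> X N m" using f(2) X_mono[of M ?L m m] X_mono[of N ?L m m] by auto
        moreover have "wnorm G (A M m) f < d" "wnorm G (A N m) f < e"
          using f(3) wnorm_X_mono[OF _ f(2), of M] wnorm_X_mono[OF _ f(2), of N] by auto
        ultimately show "f \<in> V \<inter> W" using d(2) e(2) f(1) by blast
      qed
    qed
    then show ?case by blast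
  next
    case (UN K)
    then obtain V where "V \<in> K" "(\<lambda>z. 0) \<in> V" by blast
    with UN.IH[OF this] show ?case by (meson UnionI)
  next
    case (Basis W)
    then obtain U N where U: "openin (?E N) U" and W: "W = U \<inter> (\<Inter>N. topspace (?E N))" by blast
    have "\<exists>e>0. \<forall>f\<in>topspace AHZ. f \<in> X N m \<longrightarrow> wnorm G (A N m) f < e \<longrightarrow> f \<in> W" for m
    proof -
      have "openin (H N m) {f \<in> topspace (H N m). f \<in> U}"
        using continuous_map_lc_ind[OF UN_X_subspace, of N m] U
        by (rule openin_continuous_map_preimage)
      moreover have "(\<lambda>z. 0) \<in> {f \<in> topspace (H N m). f \<in> U}"
        using X_subspace[of N m] Basis(2) unfolding W topspace_H fun_subspace_def by blast
      ultimately obtain e where e: "e > 0"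
        "\<forall>g\<in>X N m. wnorm G (A N m) g < e \<longrightarrow> g \<in> {f \<in> topspace (H N m). f \<in> U}"
        using H_zero_nbhd by blast
      have "topspace AHZ = (\<Inter>N. topspace (?E N))" unfolding AHZ_def topspace_lc_proj ..
      then show ?thesis using e unfolding W by blast
    qed
    then show ?case by blast
  qed simp
qed

text \<open>\<open>VHZ\<close> carries the finest locally convex topology, so the supremum of a family of point
  evaluations that is continuous on every step is continuous for \<open>VHZ = AHZ\<close>.\<close>

lemma evaluations_equicontinuous:
  fixes c :: "'i \<Rightarrow> real" and \<zeta> :: "'i \<Rightarrow> complex^'d"
  assumes eq: "AHZ = VHZ" and c: "\<And>i. 0 \<le> c i"
    and est: "\<And>n. \<exists>N C. \<forall>f\<in>(\<Inter>N. X N n). \<forall>i. c i * norm (f (\<zeta> i)) \<le> C * wnorm G (A N n) f"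
  shows "\<exists>M. \<forall>m. \<exists>e>0. \<forall>f\<in>topspace VHZ. f \<in> X M m \<longrightarrow> wnorm G (A M m) f < e \<longrightarrow>
    (\<forall>i. c i * norm (f (\<zeta> i)) < 1)"
proof -
  define E where "E = topspace VHZ"
  define q where "q f = (SUP i. c i * norm (f (\<zeta> i)))" for f :: "complex^'d \<Rightarrow> complex"
  have E_alt: "E = (\<Union>n. topspace (lc_proj (\<lambda>N. H N n)))"
    unfolding E_def VHZ_def by (rule topspace_lc_ind[OF UN_INT_X_subspace])
  have E: "fun_subspace E" unfolding E_alt by (rule UN_INT_X_subspace)
  have upper: "c i * norm (f (\<zeta> i)) \<le> q f" if f: "f \<in> E" for f i
  proof -
    obtain n where n: "f \<in> (\<Inter>N. X N n)" using f unfolding E_def topspace_VHZ by blast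
    obtain N C where "\<forall>i. c i * norm (f (\<zeta> i)) \<le> C * wnorm G (A N n) f" using est[of n] n by blast
    then have "bdd_above (range (\<lambda>i. c i * norm (f (\<zeta> i))))" by (auto intro!: bdd_aboveI2)
    then show ?thesis unfolding q_def by (intro cSUP_upper) auto
  qed
  have least: "q f \<le> C" if "\<And>i. c i * norm (f (\<zeta> i)) \<le> C" for f C
    unfolding q_def using that by (intro cSUP_least) auto
  have q_add: "q (\<lambda>x. f x + g x) \<le> q f + q g" if "f \<in> E" "g \<in> E" for f g
  proof (rule least)
    fix i
    have "c i * norm (f (\<zeta> i) + g (\<zeta> i)) \<le> c i * (norm (f (\<zeta> i)) + norm (g (\<zeta> i)))"
      using c by (intro mult_left_mono norm_triangle_ineq)
    then show "c i * norm (f (\<zeta> i) + g (\<zeta> i)) \<le> q f + q g"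
      using upper[OF that(1), of i] upper[OF that(2), of i] by (simp add: distrib_left)
  qed
  have q_scale: "q (\<lambda>x. b * f x) \<le> norm b * q f" if "f \<in> E" for b f
  proof (rule least)
    fix i
    show "c i * norm (b * f (\<zeta> i)) \<le> norm b * q f"
      using mult_left_mono[OF upper[OF that, of i] norm_ge_zero[of b]]
      by (simp add: norm_mult mult.left_commute)
  qed
  have q_nonneg: "0 \<le> q f" if "f \<in> E" for f
    using upper[OF that, of undefined] c[of undefined] norm_ge_zero[of "f (\<zeta> undefined)"]
    by (meson mult_nonneg_nonneg order_trans)
  let ?T = "seminorm_topology E q"
  have T: "lc_topology ?T" by (rule lc_topology_seminorm_topology[OF E q_add q_scale q_nonneg])
  have step: "continuous_map (lc_proj (\<lambda>N. H N n)) ?T (\<lambda>f. f)" for n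
    unfolding continuous_map_def
  proof (intro conjI allI impI)
    let ?F = "\<Inter>N. X N n" and ?P = "lc_proj (\<lambda>N. H N n)"
    have tP: "topspace ?P = ?F" unfolding topspace_lc_proj topspace_H ..
    show "(\<lambda>f. f) \<in> topspace ?P \<rightarrow> topspace ?T"
      unfolding topspace_seminorm_topology E_alt by blast
    fix U assume U: "openin ?T U"
    obtain N C where C: "\<forall>f\<in>?F. \<forall>i. c i * norm (f (\<zeta> i)) \<le> C * wnorm G (A N n) f"
      using est[of n] by blast
    \<comment> \<open>The given \<open>C\<close> may be zero or negative; a positive constant is
      needed for the radius r / K.\<close>
    define K where "K = max C 1"
    have K: "0 < K" "C \<le> K" by (simp_all add: K_def)
    have q_le: "q f \<le> K * wnorm G (A N n) f" if f: "f \<in> ?F" for f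
    proof (rule least)
      fix i
      have "f \<in> Ha_set G (A N n)" using f X_subset by blast
      then have "C * wnorm G (A N n) f \<le> K * wnorm G (A N n) f"
        using wnorm_nonneg[OF _ wA G(2)] K by (intro mult_right_mono) auto
      moreover have "c i * norm (f (\<zeta> i)) \<le> C * wnorm G (A N n) f" using bspec[OF C f] by blast
      ultimately show "c i * norm (f (\<zeta> i)) \<le> K * wnorm G (A N n) f" by linarith
    qed
    show "openin ?P {f \<in> topspace ?P. f \<in> U}"
    proof (subst openin_subopen, intro ballI)
      fix f assume "f \<in> {f \<in> topspace ?P. f \<in> U}"
      then have f: "f \<in> ?F" "f \<in> U" using tP by auto
      obtain r where r: "r > 0" "\<And>g. g \<in> E \<Longrightarrow> q (\<lambda>x. g x - f x) < r \<Longrightarrow> g \<in> U"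
        using U f(2) unfolding openin_seminorm_topology by meson
      let ?B = "{g \<in> X N n. wnorm G (A N n) (\<lambda>z. g z - f z) < r / K}"
      have "openin (H N n) ?B" using f(1) by (intro openin_H_ball) blast
      then have 1: "openin ?P (?B \<inter> (\<Inter>N. topspace (H N n)))"
        unfolding lc_proj_def by (intro topology_generated_by_Basis) blast
      have 2: "f \<in> ?B \<inter> (\<Inter>N. topspace (H N n))"
      proof -
        have "wnorm G (A N n) (\<lambda>z. f z - f z) \<le> 0" by (rule wnorm_least[OF G(2)]) simp
        moreover have "0 < r / K" using r(1) K(1) by simp
        ultimately show ?thesis using f(1) unfolding topspace_H by auto
      qed
      have 3: "?B \<inter> (\<Inter>N. topspace (H N n)) \<subseteq> {f \<in> topspace ?P. f \<in> U}"
      proof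
        fix g assume g: "g \<in> ?B \<inter> (\<Inter>N. topspace (H N n))"
        then have gF: "g \<in> ?F" unfolding topspace_H by blast
        from q_le[OF fun_subspace_diff[OF INT_X_subspace gF f(1)]]
        have "q (\<lambda>x. g x - f x) \<le> K * wnorm G (A N n) (\<lambda>x. g x - f x)" .
        also have "\<dots> < K * (r / K)" using g K(1) by (intro mult_strict_left_mono) auto
        also have "\<dots> = r" using K(1) by simp
        finally have less: "q (\<lambda>x. g x - f x) < r" .
        have "g \<in> E" using gF unfolding E_def topspace_VHZ by (rule UN_I[OF UNIV_I])
        from r(2)[OF this less] have "g \<in> U" .
        then show "g \<in> {f \<in> topspace ?P. f \<in> U}" using gF tP by simp
      qed
      show "\<exists>V. openin ?P V \<and> f \<in> V \<and> V \<subseteq> {f \<in> topspace ?P. f \<in> U}"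
        using 1 2 3 by (intro exI conjI)
    qed
  qed
  have cont: "continuous_map VHZ ?T (\<lambda>f. f)"
    unfolding VHZ_def using T step
    by (intro lc_ind_finest) (simp_all add: topspace_seminorm_topology E_alt)
  have zero: "(\<lambda>x. 0) \<in> E" using E unfolding fun_subspace_def by blast
  \<comment> \<open>The open unit ball of \<open>q\<close> is where the topological equality enters:
    it is open for the inductive limit, hence for the projective one.\<close>
  let ?W = "{g \<in> E. q (\<lambda>x. g x - 0) < 1}"
  have "openin ?T ?W" by (rule openin_seminorm_ball[OF E q_add q_scale q_nonneg zero])
  then have "openin VHZ {f \<in> topspace VHZ. f \<in> ?W}"
    using cont by (rule_tac openin_continuous_map_preimage)
  moreover have "{f \<in> topspace VHZ. f \<in> ?W} = ?W" unfolding E_def by blast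
  ultimately have W: "openin AHZ ?W" unfolding eq by simp
  have "q (\<lambda>x. 0) \<le> 0" by (rule least) simp
  then have "(\<lambda>x. 0) \<in> ?W" using zero by simp
  from AHZ_zero_nbhd[OF W this]
  obtain M where M: "\<forall>m. \<exists>e>0. \<forall>f\<in>topspace AHZ. f \<in> X M m \<longrightarrow> wnorm G (A M m) f < e \<longrightarrow> f \<in> ?W"
    by (rule exE)
  have "\<forall>i. c i * norm (f (\<zeta> i)) < 1" if "f \<in> ?W" for f
  proof
    fix i
    have "f \<in> E" "q f < 1" using that by auto
    from le_less_trans[OF upper[OF this(1)] this(2)] show "c i * norm (f (\<zeta> i)) < 1" .
  qed
  with M show ?thesis unfolding eq by meson
qed

section \<open>The necessary conditions\<close>

lemma cond_B_if_AHZ_eq_VHZ: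
  assumes eq: "AHZ = VHZ" shows "cond_B G A"
proof (rule cond_B_if_factorizes)
  fix n :: "nat \<Rightarrow> nat" and f
  assume "\<And>N. f \<in> Ha0_set G (A N (n N))"
  then have "f \<in> X N (n N)" for N using Ha0_set_subset_X by blast
  then have "f \<in> topspace AHZ" unfolding topspace_AHZ by blast
  then have "f \<in> (\<Union>n. \<Inter>N. X N n)" unfolding eq topspace_VHZ .
  then obtain m where "\<And>M. f \<in> X M m" by blast
  then have "\<forall>M. f \<in> Ha_set G (A M m)" using subsetD[OF X_subset] by blast
  then show "\<exists>m. \<forall>M. f \<in> Ha_set G (A M m)" ..
qed

text \<open>After division by its norm, \<open>f\<close> competes in the supremum that defines the
  growth function; norm zero is treated apart.\<close>

lemma norm_le_wnorm_assoc_growth: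
  assumes f: "f \<in> Ha_set G (A N n)" and z: "z \<in> G"
  shows "norm (f z) \<le> wnorm G (A N n) f * assoc_growth G (\<lambda>x. 1 / A N n x) z"
proof (cases "wnorm G (A N n) f = 0")
  case True
  have "A N n z * norm (f z) \<le> 0" using wnorm_upper[OF f z] True by simp
  then have "norm (f z) \<le> 0" using A_pos[OF z, of N n] by (simp add: mult_le_0_iff)
  then show ?thesis using True by simp
next
  case False
  define C where "C = wnorm G (A N n) f"
  have "C > 0" using False wnorm_nonneg[OF f wA G(2)] by (simp add: C_def)
  have "norm (of_real (1 / C) * f z) \<le> assoc_growth G (\<lambda>x. 1 / A N n x) z"
  proof (rule assoc_growth_upper[OF holo_cmult _ z])
    show "f \<in> holo G" using f by (simp add: Ha_set_def)
    fix x assume x: "x \<in> G"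
    have "A N n x * norm (f x) \<le> C" unfolding C_def by (rule wnorm_upper[OF f x])
    then show "norm (of_real (1 / C) * f x) \<le> 1 / A N n x"
      using A_pos[OF x, of N n] \<open>C > 0\<close> by (simp add: norm_mult norm_divide field_simps)
  qed
  then show ?thesis
    using \<open>C > 0\<close> unfolding C_def[symmetric] by (simp add: norm_mult norm_divide field_simps)
qed

lemma assoc_growth_mono_step:
  assumes "m \<le> n" and z: "z \<in> G"
  shows "assoc_growth G (\<lambda>x. 1 / A N m x) z \<le> assoc_growth G (\<lambda>x. 1 / A N n x) z"
proof (rule ccontr)
  assume "\<not> ?thesis"
  then have "assoc_growth G (\<lambda>x. 1 / A N n x) z < assoc_growth G (\<lambda>x. 1 / A N m x) z" by simp
  then obtain g where g: "g \<in> holo G" "\<And>x. x \<in> G \<Longrightarrow> norm (g x) \<le> 1 / A N m x"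
    "assoc_growth G (\<lambda>x. 1 / A N n x) z < norm (g z)"
  proof (rule less_assoc_growthE)
    show "0 \<le> 1 / A N m x" if "x \<in> G" for x using A_pos[OF that, of N m] by simp
  qed blast
  have "norm (g x) \<le> 1 / A N n x" if "x \<in> G" for x
  proof -
    have "1 / A N m x \<le> 1 / A N n x"
      using A_antimono_right[OF assms(1) that] A_pos[OF that] by (simp add: frac_le)
    then show ?thesis using g(2)[OF that] by linarith
  qed
  then have "norm (g z) \<le> assoc_growth G (\<lambda>x. 1 / A N n x) z"
    by (rule assoc_growth_upper[OF g(1) _ z])
  then show False using g(3) by simp
qed

text \<open>Conversely, polynomials alone determine the norm of an evaluation up to a constant. One
  factor 2 of the 4 offsets the doubled bound of the approximating polynomial, the other the
  approximation error 1/c at \<open>z\<close>.\<close>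

lemma assoc_growth_le_if_polynomials_bounded:
  assumes c: "c > 0" and e: "e > 0" and z: "z \<in> G"
    and P: "\<And>P. (\<And>N n. P \<in> Ha0_set G (A N n)) \<Longrightarrow> (\<And>x. x \<in> G \<Longrightarrow> A M m x * norm (P x) \<le> e) \<Longrightarrow>
      c * norm (P z) \<le> 1"
  shows "assoc_growth G (\<lambda>x. 1 / A M m x) z \<le> 4 / (e * c)"
proof (rule ccontr)
  assume "\<not> ?thesis"
  then have "4 / (e * c) < assoc_growth G (\<lambda>x. 1 / A M m x) z" by simp
  then obtain h where h: "h \<in> holo G" "\<And>x. x \<in> G \<Longrightarrow> norm (h x) \<le> 1 / A M m x"
    "4 / (e * c) < norm (h z)"
  proof (rule less_assoc_growthE)
    show "0 \<le> 1 / A M m x" if "x \<in> G" for x using A_pos[OF that, of M m] by simp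
  qed blast
  define f where "f x = of_real (e / 2) * h x" for x
  have fb: "A M m x * norm (f x) \<le> e / 2" if "x \<in> G" for x
  proof -
    have "A M m x * norm (h x) \<le> 1" using h(2)[OF that] A_pos[OF that, of M m] by (simp add: field_simps)
    then show ?thesis using mult_left_mono[of "A M m x * norm (h x)" 1 "e / 2"] e
      by (simp add: f_def norm_mult mult.left_commute)
  qed
  have "f \<in> holo G" unfolding f_def by (rule holo_cmult[OF h(1)])
  moreover have "0 < 1 / c" using c by simp
  ultimately obtain P where P0: "\<And>N n. P \<in> Ha0_set G (A N n)" "norm (P z - f z) < 1 / c"
    "\<forall>a C. radial G a \<longrightarrow> (\<forall>x\<in>G. 0 < a x) \<longrightarrow> (\<forall>x\<in>G. a x * norm (f x) \<le> C) \<longrightarrow>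
      (\<forall>z\<in>G. a z * norm (P z) \<le> 2 * C)"
    using weighted_polynomial_approximation[OF _ z] by blast
  have "\<forall>x\<in>G. A M m x * norm (P x) \<le> 2 * (e / 2)"
    using P0(3)[rule_format, OF radial_A A_pos fb] by blast
  then have "c * norm (P z) \<le> 1" using P[of P] P0(1) by simp
  then have "norm (P z) \<le> 1 / c" using c by (simp add: field_simps)
  moreover have "norm (f z) \<le> norm (P z) + norm (P z - f z)"
    by (metis norm_minus_commute norm_triangle_sub)
  ultimately have "norm (f z) < 2 / c" using P0(2) by (simp add: field_simps)
  moreover have "2 / c < norm (f z)"
    using h(3) c e by (simp add: f_def norm_mult field_simps)
  ultimately show False by simp
qed

lemma cond_wQ_in_if_AHZ_eq_VHZ:
  assumes eq: "AHZ = VHZ" shows "cond_wQ_in G A"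
proof (rule ccontr)
  define g where "g N n = assoc_growth G (\<lambda>x. 1 / A N n x)" for N n
  have g_pos: "0 < g N n z" if "z \<in> G" for N n z unfolding g_def by (rule assoc_growth_A_pos[OF that])
  have g_mono: "g N m z \<le> g N n z" if "m \<le> n" "z \<in> G" for N m n z
    unfolding g_def by (rule assoc_growth_mono_step[OF that])
  assume "\<not> cond_wQ_in G A"
  then have "\<not> (\<forall>N. \<exists>M\<ge>N. \<exists>n. \<forall>K\<ge>M. \<forall>m. \<exists>k. \<exists>S>0. \<forall>z\<in>G. g M m z \<le> S * max (g N n z) (g K k z))"
    unfolding cond_wQ_in_def g_def .
  then obtain N where N: "\<And>M n. M \<ge> N \<Longrightarrow>
      \<exists>K m. M \<le> K \<and> (\<forall>k S. S > 0 \<longrightarrow> (\<exists>z\<in>G. S * max (g N n z) (g K k z) < g M m z))"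
    by (metis not_le)
  \<comment> \<open>The diagonal choice M = n = N + j: it meets the constraint M \<ge> N, and both
    indices eventually pass any given bound.\<close>
  have "\<forall>j. \<exists>K m. \<forall>k S. S > 0 \<longrightarrow> (\<exists>z\<in>G. S * max (g N (N + j) z) (g K k z) < g (N + j) m z)"
    using N by (meson le_add1)
  then obtain \<kappa> \<mu> where \<kappa>\<mu>: "\<And>j k S. S > 0 \<Longrightarrow>
      \<exists>z\<in>G. S * max (g N (N + j) z) (g (\<kappa> j) k z) < g (N + j) (\<mu> j) z"
    by metis
  \<comment> \<open>The constant S = k + 1 is tied to the inner index, so the violation becomes
    arbitrarily strong along each row.\<close>
  have "\<forall>j k. \<exists>z\<in>G. (real k + 1) * max (g N (N + j) z) (g (\<kappa> j) k z) < g (N + j) (\<mu> j) z"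
    by (intro allI \<kappa>\<mu>) simp
  then obtain \<zeta> where \<zeta>: "\<And>j k. \<zeta> j k \<in> G"
    and big: "\<And>j k. (real k + 1) * max (g N (N + j) (\<zeta> j k)) (g (\<kappa> j) k (\<zeta> j k)) <
      g (N + j) (\<mu> j) (\<zeta> j k)"
    by metis
  define D where "D j k = max (g N (N + j) (\<zeta> j k)) (g (\<kappa> j) k (\<zeta> j k))" for j k
  have D_pos: "0 < D j k" for j k
    unfolding D_def using g_pos[OF \<zeta>] by (simp add: less_max_iff_disj)
  define c where "c i = (case i of (j, k) \<Rightarrow> 1 / D j k)" for i
  define z where "z i = (case i of (j, k) \<Rightarrow> \<zeta> j k)" for i
  have "\<exists>L C. \<forall>f\<in>(\<Inter>N. X N n). \<forall>i. c i * norm (f (z i)) \<le> C * wnorm G (A L n) f" for n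
  proof -
    \<comment> \<open>For step \<open>n\<close> the pairs (j, k) split in three. If j \<ge> n, then
      g N n \<le> g N (N + j) \<le> D. If j < n \<le> k, then g (\<kappa> j) n \<le> g (\<kappa> j)
      k \<le> D. The finitely many remaining pairs are absorbed in \<open>C\<close>.
      \<open>L\<close> dominates \<open>N\<close> and every \<open>\<kappa> j\<close> with j <
      n.\<close>
    define L where "L = N + (\<Sum>j<n. \<kappa> j)"
    define C where "C = 1 + (\<Sum>i\<in>{..<n} \<times> {..<n}. c i * g N n (z i))"
    have cg: "0 \<le> c i * g N n (z i)" for i
      using D_pos g_pos[OF \<zeta>] by (simp add: c_def z_def less_imp_le split: prod.split)
    then have C1: "1 \<le> C" unfolding C_def by (simp add: sum_nonneg)
    have "c (j, k) * norm (f (z (j, k))) \<le> C * wnorm G (A L n) f" if f: "f \<in> (\<Inter>N. X N n)" for f j k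
    proof -
      let ?w = "wnorm G (A L n) f" and ?z = "\<zeta> j k"
      have fH: "f \<in> Ha_set G (A M n)" for M using f X_subset by blast
      have w0: "0 \<le> ?w" by (rule wnorm_nonneg[OF fH wA G(2)])
      have ev: "norm (f ?z) \<le> ?w * g M n ?z" if "M \<le> L" for M
      proof -
        have "norm (f ?z) \<le> wnorm G (A M n) f * g M n ?z"
          unfolding g_def by (rule norm_le_wnorm_assoc_growth[OF fH \<zeta>])
        also have "\<dots> \<le> ?w * g M n ?z"
          using f g_pos[OF \<zeta>] by (intro mult_right_mono wnorm_X_mono[OF that]) (auto simp: less_imp_le)
        finally show ?thesis .
      qed
      have "norm (f ?z) \<le> C * ?w * D j k"
      proof (cases "j < n \<and> k < n")
        case True
        have "c (j, k) * g N n ?z \<le> (\<Sum>i\<in>{..<n} \<times> {..<n}. c i * g N n (z i))"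
          using member_le_sum[of "(j, k)" "{..<n} \<times> {..<n}" "\<lambda>i. c i * g N n (z i)"] True cg
          by (simp add: z_def)
        then have "c (j, k) * g N n ?z \<le> C" by (simp add: C_def)
        then have "g N n ?z \<le> C * D j k" using D_pos[of j k] by (simp add: c_def divide_le_eq)
        then have "?w * g N n ?z \<le> ?w * (C * D j k)" using w0 by (rule mult_left_mono)
        then show ?thesis using ev[of N] by (simp add: L_def ac_simps)
      next
        case False
        have "norm (f ?z) \<le> ?w * D j k"
        proof (cases "j < n")
          case True
          have "\<kappa> j \<le> L" unfolding L_def using True member_le_sum[of j "{..<n}" \<kappa>] by simp
          then have "norm (f ?z) \<le> ?w * g (\<kappa> j) n ?z" by (rule ev)
          also have "g (\<kappa> j) n ?z \<le> D j k"
            using g_mono[OF _ \<zeta>, of n k "\<kappa> j" j k] False True unfolding D_def by simp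
          finally show ?thesis using w0 by (simp add: mult_left_mono)
        next
          case False
          have "norm (f ?z) \<le> ?w * g N n ?z" by (rule ev) (simp add: L_def)
          also have "g N n ?z \<le> D j k"
            using g_mono[OF _ \<zeta>, of n "N + j" N j k] False unfolding D_def by simp
          finally show ?thesis using w0 by (simp add: mult_left_mono)
        qed
        also have "\<dots> \<le> C * (?w * D j k)"
          using mult_right_mono[OF C1, of "?w * D j k"] w0 D_pos[of j k] by simp
        finally show ?thesis by (simp add: mult.assoc)
      qed
      then show ?thesis using D_pos[of j k] by (simp add: c_def z_def divide_le_eq)
    qed
    then show ?thesis by (metis surj_pair)
  qed
  moreover have "0 \<le> c i" for i
    using D_pos by (simp add: c_def less_imp_le split: prod.split)
  ultimately obtain M where M: "\<And>m. \<exists>e>0. \<forall>f\<in>topspace VHZ. f \<in> X M m \<longrightarrow> wnorm G (A M m) f < e \<longrightarrow>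
      (\<forall>i. c i * norm (f (z i)) < 1)"
    using evaluations_equicontinuous[OF eq, of c z] by blast
  obtain e where e: "e > 0" "\<And>f i. f \<in> topspace VHZ \<Longrightarrow> f \<in> X M (\<mu> M) \<Longrightarrow>
      wnorm G (A M (\<mu> M)) f < e \<Longrightarrow> c i * norm (f (z i)) < 1"
    using M[of "\<mu> M"] by blast
  \<comment> \<open>Row j = M: the unit ball for \<open>A (N + M) (\<mu> M)\<close> lies in that for
    \<open>A M (\<mu> M)\<close>, so the neighbourhood applies. The 8 is the 4 of the polynomial
    estimate doubled by using e/2 to get below \<open>e\<close> strictly. Since \<open>e\<close>
    does not depend on \<open>k\<close>, this fails for large \<open>k\<close>.\<close>
  have bound: "real k + 1 < 8 / e" for k
  proof -
    have "g (N + M) (\<mu> M) (\<zeta> M k) \<le> 4 / (e / 2 * c (M, k))"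
      unfolding g_def
    proof (rule assoc_growth_le_if_polynomials_bounded[OF _ _ \<zeta>])
      show "0 < c (M, k)" "0 < e / 2" using D_pos e(1) by (simp_all add: c_def)
      fix P assume P: "\<And>N n. P \<in> Ha0_set G (A N n)"
        and le: "\<And>x. x \<in> G \<Longrightarrow> A (N + M) (\<mu> M) x * norm (P x) \<le> e / 2"
      have PX: "P \<in> X K n" for K n using P Ha0_set_subset_X by blast
      have "wnorm G (A M (\<mu> M)) P \<le> wnorm G (A (N + M) (\<mu> M)) P"
        by (rule wnorm_X_mono[OF _ PX]) simp
      also have "\<dots> \<le> e / 2" by (rule wnorm_least[OF G(2) le])
      also have "\<dots> < e" using e(1) by simp
      finally have "c (M, k) * norm (P (z (M, k))) < 1"
        using PX topspace_VHZ by (intro e(2)) auto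
      then show "c (M, k) * norm (P (\<zeta> M k)) \<le> 1" by (simp add: z_def)
    qed
    also have "\<dots> = 8 / e * D M k" by (simp add: c_def)
    finally have "(real k + 1) * D M k < 8 / e * D M k"
      using big[of k M] unfolding D_def by linarith
    then show ?thesis using D_pos[of M k] by (simp only: mult_less_cancel_right_pos)
  qed
  obtain k :: nat where "8 / e < real k" using reals_Archimedean2 by blast
  then show False using bound[of k] by simp
qed

end

theorem theorem5p4:
  fixes G :: "(complex^'d) set" and A :: "nat \<Rightarrow> nat \<Rightarrow> complex^'d \<Rightarrow> real"
  assumes "open G" and "G \<noteq> {}"
    and "weight_system G A"
    and "balanced_setting G A"
  shows "(AH G A = VH G A \<longrightarrow> cond_B G A \<and> cond_wQ_in G A) \<and>
         ((\<forall>N. lc_complete (AN0H G A N)) \<and> AH0 G A = V0H G A \<longrightarrow>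
            cond_B G A \<and> cond_wQ_in G A)"
proof (intro conjI impI)
  interpret full: weighted_spaces G A "\<lambda>a. UNIV"
    using assms by unfold_locales auto
  have "full.AHZ = AH G A" "full.VHZ = VH G A"
    unfolding full.AHZ_def full.VHZ_def full.H_def AH_def ANH_def VH_def by simp_all
  moreover assume "AH G A = VH G A"
  ultimately have "full.AHZ = full.VHZ" by simp
  then show "cond_B G A" "cond_wQ_in G A"
    by (rule full.cond_B_if_AHZ_eq_VHZ full.cond_wQ_in_if_AHZ_eq_VHZ)+
next
  interpret vanishing: weighted_spaces G A "Ha0_set G"
    using assms by unfold_locales auto
  have "vanishing.AHZ = AH0 G A" "vanishing.VHZ = V0H G A"
    unfolding vanishing.AHZ_def vanishing.VHZ_def vanishing.H_def AH0_def AN0H_def V0H_def Ha0_def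
    by simp_all
  moreover assume "(\<forall>N. lc_complete (AN0H G A N)) \<and> AH0 G A = V0H G A"
  ultimately have "vanishing.AHZ = vanishing.VHZ" by simp
  then show "cond_B G A" "cond_wQ_in G A"
    by (rule vanishing.cond_B_if_AHZ_eq_VHZ vanishing.cond_wQ_in_if_AHZ_eq_VHZ)+
qed

end
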